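(* Assume: (X1) the artificial data-points $(X_j)_{j\ge1}$ are realisations of a $\mathbb{P}_\psi$-ergodic process; (C2) the random sequences $(\hat\xi^{\mathrm{IS}}_{n,m})_{n\ge1}$ and $(\hat\xi^{\mathrm{NCE}}_{n,m})_{n\ge1}$ are approximate MC-MLE and NCE estimators, i.e. almost surely $\ell^{\mathrm{IS}}_{n,m}(\hat\xi^{\mathrm{IS}}_{n,m})\ge\sup_{\xi\in\Xi}\ell^{\mathrm{IS}}_{n,m}(\xi)-o(1)$ and $\ell^{\mathrm{NCE}}_{n,m}(\hat\xi^{\mathrm{NCE}}_{n,m})\ge\sup_{\xi\in\Xi}\ell^{\mathrm{NCE}}_{n,m}(\xi)-o(1)$ (with $o(1)\to0$ as $n\to\infty$), and they belong to a compact set almost surely; (H3) the maps $\theta\mapsto h_\theta(x)$ are continuous for $\mathbb{P}_\psi$-almost every $x$, and for any $\theta\in\Theta$ there is some $\varepsilon>0$ such that $$\int_{\mathcal{X}}\sup_{\phi\in B(\theta,\varepsilon)}\left(\log\frac{h_\phi(x)}{h_{\theta^\star}(x)}\right)_+h_{\theta^\star}(x)\,\mu(\mathrm{d}x)<+\infty .$$ Then both estimators $\hat\xi^{\mathrm{IS}}_{n,m}$ and $\hat\xi^{\mathrm{NCE}}_{n,m}$ converge almost surely to $\xi^\star$ as $n,m\to\infty$ while $m/n\to\tau$.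
   Context: Setting. $\Theta$ is an open subset of $\mathbb{R}^d$, $\mathcal{X}\subset\mathbb{R}^k$, $\mu$ is a measure on $\mathcal{X}$, and for each $\theta\in\Theta$, $h_\theta\ge0$ is a measurable function on $\mathcal{X}$ with $\mathcal{Z}(\theta)=\int_{\mathcal{X}}h_\theta(x)\,\mu(\mathrm{d}x)\in(0,\infty)$. $\mathbb{P}_\theta$ is the probability with density $f_\theta=h_\theta/\mathcal{Z}(\theta)$ with respect to $\mu$; the model is identifiable ($\theta\mapsto\mathbb{P}_\theta$ is injective). $\mathbb{P}_\psi$ is a probability with density $f_\psi=h_\psi/\mathcal{Z}(\psi)$ with respect to $\mu$ (where $h_\psi\geq 0$ and $\mathcal{Z}(\psi)=\int h_\psi\,\mathrm{d}\mu\in(0,\infty)$); it need not belong to the model, but $\mathbb{P}_\theta\ll\mathbb{P}_\psi$ for every $\theta\in\Theta$. $\mathbb{E}_\psi$ denotes expectation under $X\sim\mathbb{P}_\psi$. $B(\theta,\varepsilon)$ is the open ball in $\Theta$; $(u)_+=\max(u,0)$. A process $(X_j)_{j\ge1}$ is $\mathbb{P}_\psi$-ergodic if $\frac1m\sum_{j=1}^m\varphi(X_j)\to\mathbb{E}_\psi[\varphi(X)]$ almost surely as $m\to\infty$ for every measurable real-valued $\varphi$ with $\mathbb{E}_\psi|\varphi(X)|<\infty$. Observations $(Y_i)_{i\ge1}$ are IID with density $f_{\theta^\star}$ for some true parameter $\theta^\star\in\Theta$, and $(Y_i)_{i\ge1}$ is independent of $(X_j)_{j\ge1}$. $m=m_n$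 is a non-decreasing sequence of positive integers tending to infinity with $m_n/n\to\tau\in(0,+\infty)$. $\xi^\star=(\theta^\star,\nu^\star)$ with $\nu^\star=\log\{\mathcal{Z}(\psi)/\mathcal{Z}(\theta^\star)\}$. Write $\xi=(\theta,\nu)\in\Xi=\Theta\times\mathbb{R}$. The objective functions are $$\ell^{\mathrm{IS}}_{n,m}(\theta,\nu)=\frac1n\sum_{i=1}^n\log\frac{h_\theta(Y_i)}{h_\psi(Y_i)}+\nu-\frac{e^\nu}{m}\sum_{j=1}^m\frac{h_\theta(X_j)}{h_\psi(X_j)},$$ $$\ell^{\mathrm{NCE}}_{n,m}(\theta,\nu)=\frac1n\Big[\sum_{i=1}^n\log q_{\theta,\nu}(Y_i)+\sum_{j=1}^m\log\{1-q_{\theta,\nu}(X_j)\}\Big],\qquad \log\frac{q_{\theta,\nu}(x)}{1-q_{\theta,\nu}(x)}=\log\frac{h_\theta(x)}{h_\psi(x)}+\nu+\log\frac nm .$$ Convention: $\log 0=-\infty$. *)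

theory Defs
  imports "HOL-Probability.Probability"
begin

definition elog :: "real \<Rightarrow> ereal" where
  "elog u = (if 0 < u then ereal (ln u) else - \<infinity>)"

definition norm_const :: "'x measure \<Rightarrow> ('x \<Rightarrow> real) \<Rightarrow> real" where
  "norm_const \<mu> g = (\<integral>x. g x \<partial>\<mu>)"

definition norm_density :: "'x measure \<Rightarrow> ('x \<Rightarrow> real) \<Rightarrow> 'x \<Rightarrow> ennreal" where
  "norm_density \<mu> g x = ennreal (g x / norm_const \<mu> g)"

definition model_prob :: "'x measure \<Rightarrow> ('x \<Rightarrow> real) \<Rightarrow> 'x measure" where
  "model_prob \<mu> g = density \<mu> (norm_density \<mu> g)"

text \<open>The variables \<open>X j\<close> need neither be independent nor have law \<open>P\<close>. The index starts at 1.\<close>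

definition ergodic_process ::
  "'w measure \<Rightarrow> 'x measure \<Rightarrow> 'x measure \<Rightarrow> (nat \<Rightarrow> 'w \<Rightarrow> 'x) \<Rightarrow> bool" where
  "ergodic_process M \<mu> P X \<longleftrightarrow>
     (\<forall>j\<ge>1. X j \<in> measurable M \<mu>) \<and>
     (\<forall>\<phi> :: 'x \<Rightarrow> real. integrable P \<phi> \<longrightarrow>
        (AE \<omega> in M. (\<lambda>m. (\<Sum>j=1..m. \<phi> (X j \<omega>)) / real m) \<longlonglongrightarrow> (\<integral>x. \<phi> x \<partial>P)))"

text \<open>Below, \<open>h \<theta>\<close> and \<open>g\<close> are the unnormalised densities of the model and of the reference
  distribution, and \<open>y\<close>, \<open>x\<close> are the realised data. The ratio \<open>h \<theta> x / g x\<close> is only meaningful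
  where \<open>g x > 0\<close>, which is a set of full probability for the reference distribution; elsewhere it
  has the value 0 of real division by zero. Both objectives take values in \<open>[-\<infinity>, \<infinity>)\<close>.\<close>

definition lik_IS ::
  "('p \<Rightarrow> 'x \<Rightarrow> real) \<Rightarrow> ('x \<Rightarrow> real) \<Rightarrow> (nat \<Rightarrow> 'x) \<Rightarrow> (nat \<Rightarrow> 'x) \<Rightarrow> nat \<Rightarrow> nat \<Rightarrow>
   'p \<times> real \<Rightarrow> ereal" where
  "lik_IS h g y x n m = (\<lambda>(\<theta>, \<nu>).
     ereal (1 / real n) * (\<Sum>i=1..n. elog (h \<theta> (y i) / g (y i)))
     + ereal \<nu>
     - ereal (exp \<nu> / real m * (\<Sum>j=1..m. h \<theta> (x j) / g (x j))))"

text \<open>The value \<open>q = 1\<close> is excluded since the log-odds is never \<open>\<infinity>\<close>; for \<open>q = 1\<close>, the real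
  quotient \<open>q / (1 - q)\<close> would be 0.\<close>

definition nce_prob ::
  "('p \<Rightarrow> 'x \<Rightarrow> real) \<Rightarrow> ('x \<Rightarrow> real) \<Rightarrow> nat \<Rightarrow> nat \<Rightarrow> 'p \<times> real \<Rightarrow> 'x \<Rightarrow> real" where
  "nce_prob h g n m = (\<lambda>(\<theta>, \<nu>) x.
     THE q. 0 \<le> q \<and> q < 1 \<and>
       elog (q / (1 - q)) = elog (h \<theta> x / g x) + ereal \<nu> + ereal (ln (real n / real m)))"

definition lik_NCE ::
  "('p \<Rightarrow> 'x \<Rightarrow> real) \<Rightarrow> ('x \<Rightarrow> real) \<Rightarrow> (nat \<Rightarrow> 'x) \<Rightarrow> (nat \<Rightarrow> 'x) \<Rightarrow> nat \<Rightarrow> nat \<Rightarrow>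
   'p \<times> real \<Rightarrow> ereal" where
  "lik_NCE h g y x n m \<xi> =
     ereal (1 / real n) *
       ((\<Sum>i=1..n. elog (nce_prob h g n m \<xi> (y i)))
        + (\<Sum>j=1..m. elog (1 - nce_prob h g n m \<xi> (x j))))"

text \<open>Here \<open>L n\<close> is the \<open>n\<close>-th (random) objective and \<open>e\<close> is the \<open>o(1)\<close> term, which may
  be random. Finitely many \<open>n\<close> are irrelevant: the supremum may be \<open>\<infinity>\<close> for small \<open>n\<close>.\<close>

definition approx_maximiser ::
  "'w measure \<Rightarrow> 'q set \<Rightarrow> (nat \<Rightarrow> 'w \<Rightarrow> 'q \<Rightarrow> ereal) \<Rightarrow> (nat \<Rightarrow> 'w \<Rightarrow> 'q) \<Rightarrow> bool" where
  "approx_maximiser M \<Xi> L \<xi>hat \<longleftrightarrow>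
     (AE \<omega> in M. \<exists>e :: nat \<Rightarrow> real. e \<longlonglongrightarrow> 0 \<and>
        (\<forall>\<^sub>F n in sequentially. L n \<omega> (\<xi>hat n \<omega>) \<ge> (SUP \<xi>\<in>\<Xi>. L n \<omega> \<xi>) - ereal (e n)))"

lemma elog_odds_iff:
  assumes "0 \<le> a"
  shows "(0 \<le> q \<and> q < 1 \<and> elog (q / (1 - q)) = elog a + ereal c)
     \<longleftrightarrow> q = a * exp c / (1 + a * exp c)"
proof -
  have pos: "1 + a * exp c > 0"
    using assms by (simp add: add_pos_nonneg)
  have A: "elog a + ereal c = elog (a * exp c)"
    using assms by (auto simp: elog_def ln_mult zero_less_mult_iff)
  have inj: "elog u = elog v \<longleftrightarrow> u = v" if "0 \<le> u" "0 \<le> v" for u v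
    using that by (auto simp: elog_def)
  have "elog (q / (1 - q)) = elog (a * exp c) \<longleftrightarrow> q / (1 - q) = a * exp c"
    if "0 \<le> q" "q < 1"
    using that assms by (intro inj) auto
  moreover have "q / (1 - q) = a * exp c \<longleftrightarrow> q = a * exp c / (1 + a * exp c)" if "q < 1"
    using that pos by (auto simp: field_simps)
  moreover have "0 \<le> a * exp c / (1 + a * exp c)" "a * exp c / (1 + a * exp c) < 1"
    using pos assms by auto
  ultimately show ?thesis
    unfolding A by metis
qed

lemma nce_prob_eq:
  assumes "0 \<le> h \<theta> x" "0 \<le> g x" "0 < n" "0 < m"
  shows "nce_prob h g n m (\<theta>, \<nu>) x =
    (h \<theta> x / g x * exp \<nu> * (real n / real m)) / (1 + h \<theta> x / g x * exp \<nu> * (real n / real m))"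
proof -
  let ?a = "h \<theta> x / g x" and ?c = "\<nu> + ln (real n / real m)"
  have a: "0 \<le> ?a" using assms by simp
  have sum: "elog ?a + ereal \<nu> + ereal (ln (real n / real m)) = elog ?a + ereal ?c"
    by (simp add: add.assoc)
  have "exp ?c = exp \<nu> * (real n / real m)"
    using assms by (simp add: exp_add)
  then show ?thesis
    unfolding nce_prob_def prod.case sum elog_odds_iff[OF a] by (simp add: mult.assoc)
qed

end

theory Submission
  imports Defs
begin

text \<open>Put \<open>a \<xi> x = exp \<nu> * h \<theta> x / h\<psi> x\<close> for \<open>\<xi> = (\<theta>, \<nu>)\<close>. At the truth \<open>\<xi>s\<close> this is the density of the law
  \<open>Q\<close> of the observations with respect to the reference law \<open>P\<psi>\<close>, and identifiability says that
  \<open>a \<xi> = a \<xi>s\<close> almost everywhere only for \<open>\<xi> = \<xi>s\<close>. Up to constants, both objectives are functions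
  of \<open>a\<close> alone, and both are members of one family indexed by \<open>c \<ge> 0\<close>: an average over the \<open>Y i\<close> of
  \<open>ln (u / (1 + c u))\<close> minus an average over the \<open>X j\<close> of \<open>ln (1 + c u) / c\<close>, where \<open>u\<close> is the value
  of \<open>a \<xi>\<close>. The value \<open>c = 1 / \<tau>\<close> is noise contrastive estimation in the limit \<open>m / n \<rightarrow> \<tau>\<close>, and
  \<open>c = 0\<close>, where the penalty is \<open>u\<close> itself, is importance sampling.

  Consistency is Wald's argument. The excess of the objective at \<open>\<xi>\<close> over its value at \<open>\<xi>s\<close> has a
  limit that is negative for \<open>\<xi> \<noteq> \<xi>s\<close>; by continuity and domination this persists, uniformly, on a
  neighbourhood of \<open>\<xi>\<close>; finitely many such neighbourhoods cover what the compact set contains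
  outside a ball around \<open>\<xi>s\<close>; hence near-maximisers eventually enter that ball.

  Four points make this work under weak assumptions. First, only differences from \<open>\<xi>s\<close> are used, since
  the expected log-ratio \<open>ln (a \<xi>s)\<close> under \<open>Q\<close> can be infinite. Second, \<open>ln (a \<xi> / a \<xi>s)\<close> may
  have expectation \<open>- \<infinity>\<close>, so the logarithm is truncated below at \<open>- 2\<close> (lemma
  \<open>trunc_ln_le\<close>): the truncated logarithm still lies below \<open>v - 1\<close>, with equality only at \<open>v = 1\<close>,
  so that the limit remains strictly negative (lemmas \<open>contrast_le\<close>, \<open>contrast_eqD\<close> and \<open>gap\<close>). Third, an
  ergodic process may visit null sets of \<open>P\<psi>\<close>, so the upper envelope used for the \<open>X j\<close>
  dominates at every point (lemma \<open>penalty_envelope\<close>). Fourth, for the \<open>Y i\<close>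
  only an upper bound on averages is needed, and this half of the strong law has a short proof by
  the maximum of a random walk (lemma \<open>strong_law_upper\<close>).\<close>

section \<open>A one-sided strong law of large numbers\<close>

lemma (in prob_space) indep_vars_reindex:
  assumes X: "indep_vars N X I" and f: "inj_on f J" "f ` J \<subseteq> I"
  shows "indep_vars (\<lambda>j. N (f j)) (\<lambda>j. X (f j)) J"
  unfolding indep_vars_def2
proof
  show "\<forall>j\<in>J. X (f j) \<in> measurable M (N (f j))"
    using X f by (auto simp: indep_vars_def2)
  let ?F = "\<lambda>i. {X i -` A \<inter> space M | A. A \<in> sets (N i)}"
  have ind: "indep_sets ?F I"
    using X by (simp add: indep_vars_def2)
  show "indep_sets (\<lambda>j. ?F (f j)) J"
  proof (rule indep_setsI)
    show "?F (f j) \<subseteq> events" if "j \<in> J" for j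
      using ind f that unfolding indep_sets_def by blast
    fix A K assume K: "K \<noteq> {}" "K \<subseteq> J" "finite K" "\<forall>j\<in>K. A j \<in> ?F (f j)"
    have inj: "inj_on f K"
      using f K by (auto intro: inj_on_subset)
    define B where "B = A \<circ> inv_into K f"
    have B: "B (f j) = A j" if "j \<in> K" for j
      using inj that by (simp add: B_def)
    have "prob (\<Inter>i\<in>f ` K. B i) = (\<Prod>i\<in>f ` K. prob (B i))"
      using K f(2) by (intro indep_setsD[OF ind]) (auto simp: B subset_eq)
    then show "prob (\<Inter>j\<in>K. A j) = (\<Prod>j\<in>K. prob (A j))"
      using B by (simp add: prod.reindex[OF inj])
  qed
qed

text \<open>The maximum of \<open>0\<close> and the first \<open>n\<close> partial sums of \<open>z\<close>. It is defined by Lindley's recursion,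
  which exposes the first step and the maximum of the shifted walk; these are the two quantities that the
  drift argument compares.\<close>
primrec max_walk :: "nat \<Rightarrow> (nat \<Rightarrow> real) \<Rightarrow> real" where
  "max_walk 0 z = 0"
| "max_walk (Suc n) z = max 0 (z 0 + max_walk n (\<lambda>i. z (Suc i)))"

lemma max_walk_cong: "(\<And>i. i < n \<Longrightarrow> z i = z' i) \<Longrightarrow> max_walk n z = max_walk n z'"
proof (induction n arbitrary: z z')
  case (Suc n)
  have "max_walk n (\<lambda>i. z (Suc i)) = max_walk n (\<lambda>i. z' (Suc i))"
    by (rule Suc.IH) (simp add: Suc.prems)
  then show ?case by (simp add: Suc.prems)
qed simp

lemma max_walk_nonneg: "0 \<le> max_walk n z"
  by (cases n) auto

lemma max_walk_Suc_ge: "max_walk n z \<le> max_walk (Suc n) z"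
proof (induction n arbitrary: z)
  case (Suc n)
  from Suc[of "\<lambda>i. z (Suc i)"] show ?case by (simp only: max_walk.simps)
qed simp

lemma max_walk_mono: "k \<le> n \<Longrightarrow> max_walk k z \<le> max_walk n z"
  by (rule lift_Suc_mono_le[of "\<lambda>n. max_walk n z", OF max_walk_Suc_ge])

lemma partial_sum_le_max_walk: "(\<Sum>i<n. z i) \<le> max_walk n z"
proof (induction n arbitrary: z)
  case (Suc n)
  from Suc[of "\<lambda>i. z (Suc i)"] show ?case
    by (simp add: sum.lessThan_Suc_shift del: sum.lessThan_Suc)
qed simp

lemma measurable_max_walk:
  "(\<And>i. i < n \<Longrightarrow> (\<lambda>\<omega>. Z i \<omega>) \<in> borel_measurable N) \<Longrightarrow> (\<lambda>\<omega>. max_walk n (\<lambda>i. Z i \<omega>)) \<in> borel_measurable N"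
proof (induction n arbitrary: Z)
  case (Suc n)
  have [measurable]: "(\<lambda>\<omega>. max_walk n (\<lambda>i. Z (Suc i) \<omega>)) \<in> borel_measurable N"
    by (rule Suc.IH) (simp add: Suc.prems)
  have [measurable]: "Z 0 \<in> borel_measurable N"
    by (simp add: Suc.prems)
  show ?case by simp
qed simp

lemma integrable_max_walk:
  "(\<And>i. integrable N (Z i)) \<Longrightarrow> integrable N (\<lambda>\<omega>. max_walk n (\<lambda>i. Z i \<omega>))"
proof (induction n arbitrary: Z)
  case (Suc n)
  have "integrable N (\<lambda>\<omega>. max_walk n (\<lambda>i. Z (Suc i) \<omega>))"
    by (rule Suc.IH) (rule Suc.prems)
  with Suc.prems[of 0] show ?case
    by (simp del: max.bounded_iff)
qed simp

text \<open>Changing finitely many steps moves all later partial sums by a bounded amount. Hence boundedness of the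
  walk is a tail event.\<close>
lemma bounded_max_walk_shift:
  "(\<exists>b. \<forall>n. max_walk n (\<lambda>i. z (i + N)) \<le> b) \<longleftrightarrow> (\<exists>b. \<forall>n. max_walk n z \<le> b)"
proof (induction N arbitrary: z)
  case (Suc N)
  have *: "(\<exists>b. \<forall>n. max_walk n (\<lambda>i. z (Suc i)) \<le> b) \<longleftrightarrow> (\<exists>b. \<forall>n. max_walk n z \<le> b)"
  proof
    assume "\<exists>b. \<forall>n. max_walk n (\<lambda>i. z (Suc i)) \<le> b"
    then obtain b where b: "max_walk n (\<lambda>i. z (Suc i)) \<le> b" for n by blast
    have "max_walk n z \<le> max 0 (z 0 + b)" for n
      using b[of "n - 1"] by (cases n) (auto simp: le_max_iff_disj)
    then show "\<exists>b. \<forall>n. max_walk n z \<le> b" by blast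
  next
    assume "\<exists>b. \<forall>n. max_walk n z \<le> b"
    then obtain b where b: "max_walk n z \<le> b" for n by blast
    have "max_walk n (\<lambda>i. z (Suc i)) \<le> b - z 0" for n
      using b[of "Suc n"] by simp
    then show "\<exists>b. \<forall>n. max_walk n (\<lambda>i. z (Suc i)) \<le> b" by blast
  qed
  show ?case using Suc[of "\<lambda>i. z (Suc i)"] * by simp
qed simp

lemma (in prob_space) expectation_max_walk_shift:
  assumes ind: "indep_vars (\<lambda>_. borel) Z UNIV"
    and law: "\<And>i. distr M borel (Z i) = D"
  shows "expectation (\<lambda>\<omega>. max_walk n (\<lambda>i. Z (Suc i) \<omega>)) = expectation (\<lambda>\<omega>. max_walk n (\<lambda>i. Z i \<omega>))"
proof (cases n)
  case (Suc n')
  have Z [measurable]: "random_variable borel (Z i)" for i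
    using ind by (auto simp: indep_vars_def2)
  have walk [measurable]: "max_walk n \<in> borel_measurable (Pi\<^sub>M {..<n} (\<lambda>_. borel))"
    by (rule measurable_max_walk) measurable
  have *: "expectation (\<lambda>\<omega>. max_walk n (\<lambda>i. Z (i + k) \<omega>)) =
      (\<integral>v. max_walk n v \<partial>Pi\<^sub>M {..<n} (\<lambda>_. D))" for k
  proof -
    have "indep_vars (\<lambda>_. borel) (\<lambda>i. Z (i + k)) {..<n}"
      using indep_vars_reindex[OF ind, of "\<lambda>i. i + k" "{..<n}"] by (simp add: inj_on_def)
    then have "distr M (Pi\<^sub>M {..<n} (\<lambda>_. borel)) (\<lambda>\<omega>. \<lambda>i\<in>{..<n}. Z (i + k) \<omega>) = Pi\<^sub>M {..<n} (\<lambda>_. D)"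
      using law Suc by (subst (asm) indep_vars_iff_distr_eq_PiM) auto
    then have "(\<integral>v. max_walk n v \<partial>Pi\<^sub>M {..<n} (\<lambda>_. D)) = expectation (\<lambda>\<omega>. max_walk n (\<lambda>i\<in>{..<n}. Z (i + k) \<omega>))"
      using integral_distr[of "\<lambda>\<omega>. \<lambda>i\<in>{..<n}. Z (i + k) \<omega>" M "Pi\<^sub>M {..<n} (\<lambda>_. borel)" "max_walk n"] walk
      by (simp add: measurable_restrict)
    also have "\<dots> = expectation (\<lambda>\<omega>. max_walk n (\<lambda>i. Z (i + k) \<omega>))"
      by (intro Bochner_Integration.integral_cong refl max_walk_cong) auto
    finally show ?thesis ..
  qed
  from *[of 0] *[of 1] show ?thesis by simp
qed simp

lemma (in prob_space) walk_bounded_0_1: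
  fixes Z :: "nat \<Rightarrow> 'a \<Rightarrow> real"
  assumes ind: "indep_vars (\<lambda>_. borel) Z UNIV"
  defines "A \<equiv> {\<omega> \<in> space M. \<exists>b. \<forall>n. max_walk n (\<lambda>i. Z i \<omega>) \<le> b}"
  shows "A \<in> events" "prob A = 0 \<or> prob A = 1"
proof -
  define \<F> where "\<F> = (\<lambda>i. sigma_sets (space M) {Z i -` B \<inter> space M | B. B \<in> sets borel})"
  have Z [measurable]: "random_variable borel (Z i)" for i
    using ind by (auto simp: indep_vars_def2)
  have \<F>: "indep_sets \<F> UNIV"
    using ind unfolding indep_vars_def \<F>_def by blast
  have sub: "\<F> i \<subseteq> events" for i
    using \<F> by (auto simp: indep_sets_def)
  have tail: "A \<in> tail_events \<F>"
    unfolding tail_events_def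
  proof
    fix N
    define G where "G = sigma (space M) (\<Union> (\<F> ` {N..}))"
    have Pow: "\<Union> (\<F> ` {N..}) \<subseteq> Pow (space M)"
      using sub sets.sets_into_space by blast
    then have G: "sets G = sigma_sets (space M) (\<Union> (\<F> ` {N..}))" "space G = space M"
      by (auto simp: G_def)
    have Zi [measurable]: "Z (i + N) \<in> borel_measurable G" for i
    proof (rule measurableI)
      fix B :: "real set" assume "B \<in> sets borel"
      then have "Z (i + N) -` B \<inter> space M \<in> \<F> (i + N)"
        by (auto simp: \<F>_def)
      then show "Z (i + N) -` B \<inter> space G \<in> sets G"
        unfolding G by (intro sigma_sets.Basic) auto
    qed auto
    have "A = {\<omega> \<in> space M. \<exists>b. \<forall>n. max_walk n (\<lambda>i. Z (i + N) \<omega>) \<le> b}"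
      unfolding A_def by (intro Collect_cong conj_cong refl bounded_max_walk_shift[symmetric])
    \<comment> \<open>Natural bounds make this a countable union, hence measurable.\<close>
    also have "\<dots> = {\<omega> \<in> space G. \<exists>b::nat. \<forall>n. max_walk n (\<lambda>i. Z (i + N) \<omega>) \<le> real b}"
      unfolding G by (intro Collect_cong conj_cong refl iffI) (meson order_trans real_arch_simple, metis)
    also have "\<dots> \<in> sets G"
    proof -
      have [measurable]: "(\<lambda>\<omega>. max_walk n (\<lambda>i. Z (i + N) \<omega>)) \<in> borel_measurable G" for n
        by (rule measurable_max_walk) (rule Zi)
      show ?thesis by measurable
    qed
    finally show "A \<in> sigma_sets (space M) (\<Union> (\<F> ` {N..}))"
      by (simp add: G)
  qed
  show "A \<in> events"
    using tail_events_sets[of \<F>] sub tail by blast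
  show "prob A = 0 \<or> prob A = 1"
  proof (rule kolmogorov_0_1_law[OF _ \<F> tail])
    show "sigma_algebra (space M) (\<F> i)" for i
      unfolding \<F>_def by (rule sigma_algebra_sigma_sets) auto
  qed
qed

text \<open>By the zero-one law the alternative is that the walk is almost surely unbounded above. Write \<open>W n\<close> for
  the maximum of the walk with steps \<open>Z 1, Z 2, \<dots>\<close>. Lindley's recursion gives
  \<open>max_walk (n + 1) - W n = max (- W n) (Z 0)\<close>, and the left-hand side has nonnegative expectation
  because \<open>W n\<close> has the law of \<open>max_walk n\<close>. If \<open>W n\<close> tends to infinity, the right-hand side tends
  to \<open>Z 0\<close>, dominated by \<open>\<bar>Z 0\<bar>\<close>; so \<open>Z 0\<close> would have nonnegative expectation.\<close>
lemma (in prob_space) walk_negative_drift_bounded: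
  fixes Z :: "nat \<Rightarrow> 'a \<Rightarrow> real"
  assumes ind: "indep_vars (\<lambda>_. borel) Z UNIV"
    and law: "\<And>i. distr M borel (Z i) = D"
    and int: "\<And>i. integrable M (Z i)"
    and drift: "expectation (Z 0) < 0"
  shows "AE \<omega> in M. \<exists>b. \<forall>n. (\<Sum>i<n. Z i \<omega>) \<le> b"
proof -
  have [measurable]: "random_variable borel (Z i)" for i
    using ind by (auto simp: indep_vars_def2)
  define A where "A = {\<omega> \<in> space M. \<exists>b. \<forall>n. max_walk n (\<lambda>i. Z i \<omega>) \<le> b}"
  have A [measurable]: "A \<in> events" and "prob A = 0 \<or> prob A = 1"
    unfolding A_def by (fact walk_bounded_0_1[OF ind])+
  then consider "prob A = 0" | "prob A = 1" by blast
  then have "AE \<omega> in M. \<omega> \<in> A"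
  proof cases
    case 1
    define W where "W n \<omega> = max_walk n (\<lambda>i. Z (Suc i) \<omega>)" for n \<omega>
    have [measurable]: "random_variable borel (W n)" for n
      unfolding W_def by (rule measurable_max_walk) measurable
    have "AE \<omega> in M. \<omega> \<in> space M - A"
      using 1 A by (simp add: prob_eq_0)
    then have unb: "AE \<omega> in M. filterlim (\<lambda>n. W n \<omega>) at_top sequentially"
    proof eventually_elim
      case (elim \<omega>)
      show ?case
        unfolding filterlim_at_top
      proof
        fix c
        show "\<forall>\<^sub>F n in sequentially. c \<le> W n \<omega>"
        proof -
          have "\<nexists>b. \<forall>n. W n \<omega> \<le> b"
            using elim bounded_max_walk_shift[of "\<lambda>i. Z i \<omega>" 1] by (auto simp: A_def W_def)
          then obtain N where "c \<le> W N \<omega>" by (meson nle_le)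
          then show ?thesis
            using max_walk_mono by (intro eventually_sequentiallyI[of N]) (auto simp: W_def intro: order_trans)
        qed
      qed
    qed
    have "(\<lambda>n. expectation (\<lambda>\<omega>. max (- W n \<omega>) (Z 0 \<omega>))) \<longlonglongrightarrow> expectation (Z 0)"
    proof (rule integral_dominated_convergence)
      show "integrable M (\<lambda>\<omega>. \<bar>Z 0 \<omega>\<bar>)" using int by auto
      show "AE \<omega> in M. norm (max (- W n \<omega>) (Z 0 \<omega>)) \<le> \<bar>Z 0 \<omega>\<bar>" for n
        using max_walk_nonneg[of n] by (intro AE_I2) (auto simp: W_def max_def not_le)
      show "AE \<omega> in M. (\<lambda>n. max (- W n \<omega>) (Z 0 \<omega>)) \<longlonglongrightarrow> Z 0 \<omega>"
        using unb
      proof eventually_elim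
        case (elim \<omega>)
        then have "\<forall>\<^sub>F n in sequentially. - Z 0 \<omega> \<le> W n \<omega>"
          by (simp add: filterlim_at_top)
        then show ?case
          by (intro tendsto_eventually) (auto elim!: eventually_mono)
      qed
    qed auto
    moreover have "0 \<le> expectation (\<lambda>\<omega>. max (- W n \<omega>) (Z 0 \<omega>))" for n
    proof -
      have W: "integrable M (W n)" "integrable M (\<lambda>\<omega>. max_walk k (\<lambda>i. Z i \<omega>))" for n k
        unfolding W_def using int by (auto intro!: integrable_max_walk)
      have "expectation (W n) = expectation (\<lambda>\<omega>. max_walk n (\<lambda>i. Z i \<omega>))"
        unfolding W_def by (rule expectation_max_walk_shift[OF ind law])
      also have "\<dots> \<le> expectation (\<lambda>\<omega>. max_walk (Suc n) (\<lambda>i. Z i \<omega>))"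
        by (rule integral_mono[OF W(2) W(2) max_walk_Suc_ge])
      finally have "0 \<le> expectation (\<lambda>\<omega>. max_walk (Suc n) (\<lambda>i. Z i \<omega>)) - expectation (W n)"
        by simp
      also have "\<dots> = expectation (\<lambda>\<omega>. max_walk (Suc n) (\<lambda>i. Z i \<omega>) - W n \<omega>)"
        by (rule Bochner_Integration.integral_diff[OF W(2) W(1), symmetric])
      also have "\<dots> = expectation (\<lambda>\<omega>. max (- W n \<omega>) (Z 0 \<omega>))"
        by (intro Bochner_Integration.integral_cong) (auto simp: W_def)
      finally show ?thesis .
    qed
    ultimately have "0 \<le> expectation (Z 0)"
      by (intro LIMSEQ_le_const[where a = 0]) auto
    with drift show ?thesis by simp
  next
    case 2
    then show ?thesis using A by (simp add: prob_eq_1)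
  qed
  then show ?thesis
  proof eventually_elim
    case (elim \<omega>)
    then obtain b where "max_walk n (\<lambda>i. Z i \<omega>) \<le> b" for n
      by (auto simp: A_def)
    then show ?case
      using partial_sum_le_max_walk[of "\<lambda>i. Z i \<omega>"] by (meson order_trans)
  qed
qed

text \<open>Subtracting a constant strictly between the mean and \<open>c\<close> leaves a walk with negative drift. Its partial
  sums are bounded, so the averages are eventually below \<open>c\<close>.\<close>
lemma (in prob_space) strong_law_upper:
  fixes F :: "'b \<Rightarrow> real"
  assumes ind: "indep_vars (\<lambda>_. N) Y {1..}"
    and law: "\<And>i. 1 \<le> i \<Longrightarrow> distr M N (Y i) = Q"
    and F: "integrable Q F" and c: "(\<integral>y. F y \<partial>Q) < c"
  shows "AE \<omega> in M. \<forall>\<^sub>F n in sequentially. (\<Sum>i=1..n. F (Y i \<omega>)) / real n < c"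
proof -
  define e where "e = (c - (\<integral>y. F y \<partial>Q)) / 2"
  have e: "0 < e" using c by (simp add: e_def)
  define Z where "Z = (\<lambda>i \<omega>. F (Y (Suc i) \<omega>) - (c - e))"
  have Y [measurable]: "Y (Suc i) \<in> measurable M N" for i
    using ind by (auto simp: indep_vars_def2)
  have Q: "sets Q = sets N" using arg_cong[OF law[of 1], of sets] by simp
  have [measurable]: "F \<in> borel_measurable N"
    using F Q by (metis borel_measurable_integrable measurable_cong_sets)
  have "indep_vars (\<lambda>_. N) (\<lambda>i. Y (Suc i)) UNIV"
    using indep_vars_reindex[OF ind, of Suc UNIV] by auto
  then have "indep_vars (\<lambda>_. borel) (\<lambda>i. (\<lambda>y. F y - (c - e)) \<circ> Y (Suc i)) UNIV"
    by (rule indep_vars_compose) auto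
  then have indZ: "indep_vars (\<lambda>_. borel) Z UNIV"
    by (simp add: Z_def comp_def)
  have FY: "integrable M (\<lambda>\<omega>. F (Y (Suc i) \<omega>))"
      "expectation (\<lambda>\<omega>. F (Y (Suc i) \<omega>)) = (\<integral>y. F y \<partial>Q)" for i
    using F integrable_distr_eq[OF Y[of i], of F] integral_distr[OF Y[of i], of F]
    unfolding law[of "Suc i", simplified] by simp_all
  have "AE \<omega> in M. \<exists>b. \<forall>n. (\<Sum>i<n. Z i \<omega>) \<le> b"
  proof (rule walk_negative_drift_bounded[OF indZ])
    show "distr M borel (Z i) = distr Q borel (\<lambda>y. F y - (c - e))" for i
    proof -
      have "distr Q borel (\<lambda>y. F y - (c - e)) = distr (distr M N (Y (Suc i))) borel (\<lambda>y. F y - (c - e))"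
        unfolding law[of "Suc i", simplified] ..
      also have "\<dots> = distr M borel (Z i)"
        by (subst distr_distr) (auto simp: Z_def comp_def)
      finally show ?thesis ..
    qed
    show "integrable M (Z i)" for i
      using FY by (auto simp: Z_def)
    have "expectation (Z 0) = (\<integral>y. F y \<partial>Q) - (c - e)"
      using FY[of 0] by (simp add: Z_def prob_space)
    also have "\<dots> = - e" by (simp add: e_def field_simps)
    finally show "expectation (Z 0) < 0" using e by simp
  qed
  then show ?thesis
  proof eventually_elim
    case (elim \<omega>)
    then obtain b where b: "(\<Sum>i<n. Z i \<omega>) \<le> b" for n by blast
    obtain N :: nat where N: "b / e < real N" using reals_Archimedean2 by blast
    show ?case
    proof (intro eventually_sequentiallyI[of "max 1 N"])
      fix n assume n: "max 1 N \<le> n"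
      have "(\<Sum>i=1..n. F (Y i \<omega>)) = (\<Sum>i<n. F (Y (Suc i) \<omega>))"
        by (simp add: sum.atLeast1_atMost_eq lessThan_atLeast0)
      also have "\<dots> = (\<Sum>i<n. Z i \<omega>) + real n * (c - e)"
        by (simp add: Z_def sum_subtractf)
      also have "\<dots> < real n * e + real n * (c - e)"
      proof -
        have "b / e < real n" using N n by simp
        then have "b < real n * e" using e by (simp add: field_simps)
        then show ?thesis using b[of n] by simp
      qed
      also have "\<dots> = real n * c" by (simp add: algebra_simps)
      finally show "(\<Sum>i=1..n. F (Y i \<omega>)) / real n < c"
        using n by (simp add: divide_less_eq mult.commute)
    qed
  qed
qed

section \<open>Truncated logarithm, saturation and penalty\<close>

text \<open>The logarithm truncated below at \<open>- 2\<close>, which keeps expectations of log-ratios away from \<open>- \<infinity>\<close>. Any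
  level below \<open>- 1\<close> would do: on the truncated part the value must stay below \<open>u - 1 \<ge> - 1\<close>.\<close>
definition trunc_ln :: "real \<Rightarrow> real" where
  "trunc_ln u = ln (max u (exp (- 2)))"

lemma trunc_ln_ge: "- 2 \<le> trunc_ln u"
proof -
  have "ln (exp (- 2)) \<le> trunc_ln u"
    unfolding trunc_ln_def by (rule ln_mono) auto
  then show ?thesis by simp
qed

lemma trunc_ln_mono: "u \<le> v \<Longrightarrow> trunc_ln u \<le> trunc_ln v"
  unfolding trunc_ln_def by (intro ln_mono) (auto simp: less_max_iff_disj)

lemma ln_le_trunc_ln: "0 < u \<Longrightarrow> ln u \<le> trunc_ln u"
  unfolding trunc_ln_def by (intro ln_mono) (auto simp: less_max_iff_disj)

lemma isCont_trunc_ln: "isCont trunc_ln u"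
proof -
  have "max u (exp (- 2)) \<noteq> 0"
    by (metis exp_gt_zero less_max_iff_disj order_less_irrefl)
  then show ?thesis
    unfolding trunc_ln_def[abs_def] by (intro continuous_intros)
qed

lemma continuous_on_trunc_ln [continuous_intros]:
  "continuous_on S f \<Longrightarrow> continuous_on S (\<lambda>x. trunc_ln (f x))"
  by (rule continuous_on_compose2[of UNIV trunc_ln])
    (auto intro: continuous_at_imp_continuous_on isCont_trunc_ln)

lemma measurable_trunc_ln [measurable]: "trunc_ln \<in> borel_measurable borel"
  unfolding trunc_ln_def[abs_def] by measurable

lemma
  assumes u: "0 \<le> u"
  shows trunc_ln_le: "trunc_ln u \<le> u - 1" and trunc_ln_eqD: "trunc_ln u = u - 1 \<Longrightarrow> u = 1"
proof -
  have "trunc_ln u \<le> u - 1 \<and> (trunc_ln u = u - 1 \<longrightarrow> u = 1)"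
  proof (cases "exp (- 2) \<le> u")
    case True
    then have "0 < u" by (meson exp_gt_zero less_le_trans)
    then show ?thesis
      using True ln_le_minus_one[of u] ln_eq_minus_one[of u] by (auto simp: trunc_ln_def max_def)
  next
    case False
    then have "trunc_ln u = - 2" by (simp add: trunc_ln_def max_def)
    then show ?thesis using u by simp
  qed
  then show "trunc_ln u \<le> u - 1" "trunc_ln u = u - 1 \<Longrightarrow> u = 1" by auto
qed

text \<open>The truncation does not affect the positive part, which is what the integrability assumption on the
  log-ratios controls.\<close>
lemma trunc_ln_pos_part: "ennreal (max 0 (trunc_ln u)) = e2ennreal (max (elog u) 0)"
proof (cases "0 < u")
  case True
  have "max 0 (trunc_ln u) = max 0 (ln u)"
  proof (cases "exp (- 2) \<le> u")
    case True
    then show ?thesis by (simp add: trunc_ln_def max_def)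
  next
    case False
    then have "ln u \<le> - 2"
      using True by (metis ln_exp ln_le_cancel_iff exp_gt_zero linear)
    with False show ?thesis by (simp add: trunc_ln_def max_def)
  qed
  moreover have "max (elog u) 0 = ereal (max 0 (ln u))"
    using True by (auto simp: elog_def max_def zero_ereal_def)
  ultimately show ?thesis by (simp only: e2ennreal_ereal)
next
  case False
  then have "u \<le> exp (- 2)"
    by (meson exp_ge_zero linorder_not_less order_trans)
  then have "trunc_ln u = - 2"
    by (simp add: trunc_ln_def max_def)
  with False show ?thesis by (simp add: elog_def)
qed

lemma trunc_ln_exp_mult_le:
  assumes "0 \<le> u"
  shows "trunc_ln (exp d * u) \<le> max 0 (trunc_ln u) + \<bar>d\<bar>"
proof (cases "exp (- 2) \<le> exp d * u")
  case True
  then have "0 < exp d * u" by (meson exp_gt_zero less_le_trans)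
  then have u: "0 < u" by (simp add: zero_less_mult_iff)
  have "trunc_ln (exp d * u) = d + ln u"
    using True u by (simp add: trunc_ln_def max_def ln_mult)
  also have "\<dots> \<le> \<bar>d\<bar> + max 0 (trunc_ln u)"
    using ln_le_trunc_ln[OF u] by linarith
  finally show ?thesis by simp
next
  case False
  then have "trunc_ln (exp d * u) = - 2" by (simp add: trunc_ln_def max_def)
  then show ?thesis by simp
qed

text \<open>If \<open>u\<close> is a density ratio and \<open>c\<close> the ratio of the two sample sizes, then \<open>c * saturate c u\<close> is the
  probability, in noise contrastive estimation, that a point is an observation, and
  \<open>- c * penalty c u\<close> is the logarithm of the complementary probability. At \<open>c = 0\<close>, division by zero in
  \<open>penalty\<close> has to be replaced by the limit \<open>c \<rightarrow> 0\<close>, which is the importance sampling penalty.\<close>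
definition saturate :: "real \<Rightarrow> real \<Rightarrow> real" where
  "saturate c u = u / (1 + c * u)"

definition penalty :: "real \<Rightarrow> real \<Rightarrow> real" where
  "penalty c u = (if c = 0 then u else ln (1 + c * u) / c)"

lemma one_plus_pos: "0 \<le> c \<Longrightarrow> 0 \<le> u \<Longrightarrow> 0 < 1 + c * (u::real)"
  by (simp add: add_pos_nonneg)

lemma penalty_nonneg: "0 \<le> c \<Longrightarrow> 0 \<le> u \<Longrightarrow> 0 \<le> penalty c u"
  by (simp add: penalty_def)

lemma penalty_le: "0 \<le> c \<Longrightarrow> 0 \<le> u \<Longrightarrow> penalty c u \<le> u"
  using ln_add_one_self_le_self[of "c * u"] by (auto simp: penalty_def field_simps)

lemma continuous_on_penalty:
  assumes "0 \<le> c" "continuous_on S f" "\<And>x. x \<in> S \<Longrightarrow> 0 \<le> f x"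
  shows "continuous_on S (\<lambda>x. penalty c (f x))"
proof (cases "c = 0")
  case False
  have "1 + c * f x \<noteq> 0" if "x \<in> S" for x
    using one_plus_pos[of c "f x"] assms that by auto
  then show ?thesis
    using assms False by (auto simp: penalty_def intro!: continuous_intros)
qed (use assms in \<open>simp add: penalty_def\<close>)

lemma continuous_on_saturate:
  assumes "0 \<le> c" "continuous_on S f" "\<And>x. x \<in> S \<Longrightarrow> 0 \<le> f x"
  shows "continuous_on S (\<lambda>x. saturate c (f x))"
proof -
  have "1 + c * f x \<noteq> 0" if "x \<in> S" for x
    using one_plus_pos[of c "f x"] assms that by auto
  then show ?thesis
    using assms by (auto simp: saturate_def intro!: continuous_intros)
qed

lemma measurable_penalty [measurable]: "penalty c \<in> borel_measurable borel"
  unfolding penalty_def[abs_def] by measurable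

lemma measurable_saturate [measurable]: "saturate c \<in> borel_measurable borel"
  unfolding saturate_def[abs_def] by measurable

lemma penalty_diff_le:
  assumes c: "0 \<le> c" and a: "0 \<le> a" and u: "0 \<le> u"
  shows "penalty c a - penalty c u \<le> (a - u) / (1 + c * u)"
proof (cases "c = 0")
  case False
  have pos: "0 < 1 + c * a" "0 < 1 + c * u"
    using assms by (auto intro: one_plus_pos)
  have "ln (1 + c * a) - ln (1 + c * u) = ln ((1 + c * a) / (1 + c * u))"
    using pos by (simp add: ln_div)
  also have "\<dots> \<le> (1 + c * a) / (1 + c * u) - 1"
    using pos by (intro ln_le_minus_one) auto
  also have "\<dots> = c * ((a - u) / (1 + c * u))"
    using pos by (simp add: field_simps)
  finally show ?thesis
    using False c by (simp add: penalty_def field_simps)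
qed (simp add: penalty_def)

text \<open>The integrand, with respect to the reference law, of the limiting contrast between a parameter with
  density ratio \<open>u\<close> and the truth with density ratio \<open>a\<close>. Bounding each logarithm by its argument minus \<open>1\<close> leaves
  \<open>(u - a) / (1 + c u) + (a - u) / (1 + c u) = 0\<close> when \<open>a > 0\<close>, and
  \<open>- u / (1 + c u)\<close> when \<open>a = 0\<close>. In the first case equality forces the argument of \<open>trunc_ln\<close> to be \<open>1\<close>,
  and \<open>saturate c\<close> is injective; in the second it forces \<open>u = 0\<close>.\<close>
lemma
  assumes c: "0 \<le> c" and a: "0 \<le> a" and u: "0 \<le> u"
  shows contrast_le: "a * trunc_ln (saturate c u / saturate c a) + (penalty c a - penalty c u) \<le> 0"
    and contrast_eqD: "a * trunc_ln (saturate c u / saturate c a) + (penalty c a - penalty c u) = 0 \<Longrightarrow> u = a"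
proof -
  have pos: "0 < 1 + c * a" "0 < 1 + c * u"
    using assms by (auto intro: one_plus_pos)
  define v where "v = saturate c u / saturate c a"
  have v: "0 \<le> v" using pos a u by (simp add: v_def saturate_def)
  have eq: "a * (v - 1) + (a - u) / (1 + c * u) = (if a = 0 then - saturate c u else 0)"
  proof (cases "a = 0")
    case True
    then show ?thesis by (simp add: saturate_def)
  next
    case False
    then have "a * (v - 1) = (u * (1 + c * a) - a * (1 + c * u)) / (1 + c * u)"
      using pos by (simp add: v_def saturate_def diff_divide_distrib right_diff_distrib)
    also have "u * (1 + c * a) - a * (1 + c * u) = - (a - u)"
      by (simp add: algebra_simps)
    finally show ?thesis using False by (simp add: diff_divide_distrib)
  qed
  have saturate: "0 \<le> saturate c u" using pos u by (simp add: saturate_def)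
  have 1: "a * trunc_ln v \<le> a * (v - 1)"
    using trunc_ln_le[OF v] a by (rule mult_left_mono)
  note 2 = penalty_diff_le[OF c a u]
  show "a * trunc_ln v + (penalty c a - penalty c u) \<le> 0"
    using 1 2 eq saturate by (auto split: if_splits)
  assume 0: "a * trunc_ln v + (penalty c a - penalty c u) = 0"
  show "u = a"
  proof (cases "a = 0")
    case True
    then have "saturate c u = 0" using 0 1 2 eq saturate by auto
    with pos True show ?thesis by (simp add: saturate_def)
  next
    case False
    then have "a * trunc_ln v = a * (v - 1)" using 0 1 2 eq by (simp only: if_False)
    then have "v = 1" using False trunc_ln_eqD[OF v] by simp
    then have "saturate c u = saturate c a" by (simp add: v_def)
    then show ?thesis using pos by (simp add: saturate_def field_simps)
  qed
qed

text \<open>Transfers the domination of the log-ratio from \<open>c = 0\<close> to every \<open>c\<close>.\<close>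
lemma saturate_ratio_le:
  assumes c: "0 \<le> c" and a: "0 < a" and u: "0 \<le> u"
  shows "saturate c u / saturate c a \<le> max 1 (u / a)"
proof (cases "u \<le> a")
  case True
  have pos: "0 < 1 + c * a" "0 < 1 + c * u"
    using assms by (auto intro: one_plus_pos)
  have "u * (1 + c * a) \<le> a * (1 + c * u)"
    using True by (simp add: algebra_simps)
  then have "saturate c u / saturate c a \<le> 1"
    using pos a by (simp add: saturate_def divide_simps mult.commute)
  then show ?thesis by simp
next
  case False
  have pos: "0 < 1 + c * a" "0 < 1 + c * u"
    using assms by (auto intro: one_plus_pos)
  have "1 + c * a \<le> 1 + c * u"
    using False c by (simp add: mult_left_mono)
  then have "saturate c u / saturate c a \<le> u / a"
    using pos a u by (simp add: saturate_def divide_simps mult_left_mono)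
  then show ?thesis by simp
qed

text \<open>The bound does not depend on \<open>u\<close>. This lets the ratio of the sample sizes be replaced by its limit,
  uniformly in the parameter and the data.\<close>
lemma ln_one_plus_scale:
  fixes c r u :: real
  assumes "0 < c" "0 < r" "0 \<le> u"
  shows "\<bar>ln (1 + r * u) - ln (1 + c * u)\<bar> \<le> \<bar>ln (r / c)\<bar>"
proof -
  have *: "\<bar>ln (1 + r * u) - ln (1 + c * u)\<bar> \<le> \<bar>ln (r / c)\<bar>" if "0 < c" "c \<le> r" for r c
  proof -
    have r: "0 < r" using that by linarith
    have pos: "0 < 1 + c * u" "0 < 1 + r * u"
      using that r assms(3) by (auto intro!: one_plus_pos)
    have le: "1 + c * u \<le> 1 + r * u"
      using that assms by (simp add: mult_right_mono)
    have "1 + r * u \<le> (r / c) * (1 + c * u)"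
      using that by (simp add: field_simps)
    then have "ln (1 + r * u) \<le> ln ((r / c) * (1 + c * u))"
      using pos r that by (intro ln_mono) auto
    also have "\<dots> = ln (r / c) + ln (1 + c * u)"
      using pos r that by (intro ln_mult_pos) auto
    finally show ?thesis
      using ln_mono[OF le pos(1)] by linarith
  qed
  show ?thesis
  proof (cases "c \<le> r")
    case True
    with * assms show ?thesis by blast
  next
    case False
    then have "\<bar>ln (1 + c * u) - ln (1 + r * u)\<bar> \<le> \<bar>ln (c / r)\<bar>"
      using *[of r c] assms by simp
    then show ?thesis using assms by (simp add: ln_div abs_minus_commute)
  qed
qed

text \<open>This turns bounds along a countable set of parameters into bounds for all parameters of an open set.\<close>
lemma continuous_le_from_dense:
  fixes f :: "'p::topological_space \<Rightarrow> real"
  assumes U: "open U" and cont: "continuous_on U f"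
    and D: "\<And>W. open W \<Longrightarrow> W \<noteq> {} \<Longrightarrow> \<exists>d\<in>D. d \<in> W"
    and le: "\<And>d. d \<in> D \<inter> U \<Longrightarrow> f d \<le> b"
    and q: "q \<in> U"
  shows "f q \<le> b"
proof (rule ccontr)
  assume "\<not> f q \<le> b"
  define W where "W = f -` {b<..} \<inter> U"
  have "open W"
    using cont unfolding W_def by (simp add: continuous_on_open_vimage[OF U])
  moreover have "q \<in> W" using q \<open>\<not> f q \<le> b\<close> by (simp add: W_def)
  ultimately obtain d where "d \<in> D" "d \<in> W" using D[of W] by blast
  with le[of d] show False by (simp add: W_def)
qed

text \<open>The suprema over shrinking balls decrease to the value at the centre, by continuity, and are caught between
  \<open>f p\<close> and \<open>S\<close>, so dominated convergence applies.\<close>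
lemma upper_envelope:
  fixes f :: "'p::{metric_space, second_countable_topology} \<Rightarrow> 'x \<Rightarrow> real"
  assumes V: "open V" "p \<in> V"
    and meas: "\<And>q. q \<in> V \<Longrightarrow> f q \<in> borel_measurable N"
    and fp: "integrable N (f p)" and S: "integrable N S"
    and cont: "AE x in N. continuous_on V (\<lambda>q. f q x)"
    and dom: "AE x in N. \<forall>q\<in>V. f q x \<le> S x"
    and \<delta>: "0 < \<delta>"
  shows "\<exists>U F. open U \<and> p \<in> U \<and> U \<subseteq> V \<and> integrable N F \<and>
    (AE x in N. \<forall>q\<in>U. f q x \<le> F x) \<and> (\<integral>x. F x \<partial>N) < (\<integral>x. f p x \<partial>N) + \<delta>"
proof -
  obtain e where e: "0 < e" "ball p e \<subseteq> V"
    using V by (auto simp: open_contains_ball)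
  obtain D :: "'p set" where D: "countable D" "\<And>W. open W \<Longrightarrow> W \<noteq> {} \<Longrightarrow> \<exists>d\<in>D. d \<in> W"
    by (rule countable_dense_setE) blast
  define U where "U k = ball p (e / real (Suc k))" for k
  have U: "open (U k)" "p \<in> U k" "U k \<subseteq> V" for k
  proof -
    have "e / real (Suc k) \<le> e" using e by (simp add: field_simps)
    then show "U k \<subseteq> V" using e unfolding U_def by (meson order_trans subset_ball)
  qed (use e in \<open>auto simp: U_def\<close>)
  define I where "I k = insert p (D \<inter> U k)" for k
  have I: "countable (I k)" "I k \<noteq> {}" "p \<in> I k" "I k \<subseteq> U k" for k
    using D U by (auto simp: I_def)
  \<comment> \<open>The supremum runs over a countable set to be measurable; adding \<open>p\<close> gives the lower bound
    \<open>f p\<close>, and the cut at \<open>S\<close> keeps it finite on the exceptional null set too.\<close>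
  define F where "F k x = (SUP q\<in>I k. min (f q x) (S x))" for k x
  have [measurable]: "S \<in> borel_measurable N" using S by auto
  have bdd: "bdd_above ((\<lambda>q. min (f q x) (S x)) ` I k)" for k x
    by (auto simp: bdd_above_def intro!: exI[of _ "S x"])
  have F_meas [measurable]: "F k \<in> borel_measurable N" for k
    unfolding F_def
  proof (rule borel_measurable_cSUP[OF I(1)])
    show "(\<lambda>x. min (f q x) (S x)) \<in> borel_measurable N" if "q \<in> I k" for q
      using meas[of q] that I(4)[of k] U(3)[of k] by auto
  qed (rule bdd)
  have bounds: "f p x \<le> F k x" "F k x \<le> S x"
    if "\<forall>q\<in>V. f q x \<le> S x" for x k
  proof -
    have "min (f p x) (S x) \<le> F k x"
      unfolding F_def by (rule cSUP_upper[OF I(3) bdd])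
    then show "f p x \<le> F k x" using that V by (auto simp: min_def split: if_splits)
    show "F k x \<le> S x"
      unfolding F_def using I(2) by (intro cSUP_least) auto
  qed
  have above: "f q x \<le> F k x"
    if x: "continuous_on V (\<lambda>q. f q x)" "\<forall>q\<in>V. f q x \<le> S x" and q: "q \<in> U k" for x k q
  proof (rule continuous_le_from_dense[OF U(1) _ D(2) _ q])
    show "continuous_on (U k) (\<lambda>q. f q x)"
      using x(1) U(3) by (rule continuous_on_subset)
    fix d assume d: "d \<in> D \<inter> U k"
    then have "min (f d x) (S x) \<le> F k x"
      unfolding F_def by (intro cSUP_upper bdd) (auto simp: I_def)
    moreover have "f d x \<le> S x" using x(2) d U(3)[of k] by auto
    ultimately show "f d x \<le> F k x" by (simp add: min_def)
  qed
  have lim: "(\<lambda>k. F k x) \<longlonglongrightarrow> f p x"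
    if x: "continuous_on V (\<lambda>q. f q x)" "\<forall>q\<in>V. f q x \<le> S x" for x
  proof (rule LIMSEQ_I)
    fix r :: real assume r: "0 < r"
    obtain d where d: "0 < d" "\<And>q. q \<in> V \<Longrightarrow> dist q p < d \<Longrightarrow> dist (f q x) (f p x) < r / 2"
      using x(1) V r unfolding continuous_on_iff by (meson half_gt_zero)
    obtain k0 :: nat where k0: "e / d < real k0" using reals_Archimedean2 by blast
    show "\<exists>k0. \<forall>k\<ge>k0. norm (F k x - f p x) < r"
    proof (intro exI allI impI)
      fix k assume k: "k0 \<le> k"
      have "e / d < real (Suc k)" using k0 k by simp
      then have small: "e / real (Suc k) < d" using d(1) by (simp add: field_simps)
      have "F k x \<le> f p x + r / 2"
        unfolding F_def
      proof (rule cSUP_least[OF I(2)])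
        fix q assume "q \<in> I k"
        then have "q \<in> U k" using I(4) by blast
        then have "q \<in> V" "dist q p < d"
          using U(3)[of k] small by (auto simp: U_def dist_commute)
        then have "dist (f q x) (f p x) < r / 2" by (rule d(2))
        then have "f q x \<le> f p x + r / 2" unfolding dist_real_def by linarith
        then show "min (f q x) (S x) \<le> f p x + r / 2" by (rule min.coboundedI1)
      qed
      then show "norm (F k x - f p x) < r"
        using bounds(1)[OF x(2), of k] r by simp
    qed
  qed
  have abs_int: "integrable N (\<lambda>x. \<bar>f p x\<bar> + \<bar>S x\<bar>)" using fp S by auto
  have dominated: "AE x in N. norm (F k x) \<le> \<bar>f p x\<bar> + \<bar>S x\<bar>" for k
    using dom
  proof eventually_elim
    case (elim x)
    from bounds[OF elim, of k] show ?case unfolding real_norm_def by linarith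
  qed
  have FI: "integrable N (F k)" for k
    by (rule Bochner_Integration.integrable_bound[OF abs_int F_meas])
      (use dominated[of k] in \<open>eventually_elim, simp\<close>)
  have "(\<lambda>k. \<integral>x. F k x \<partial>N) \<longlonglongrightarrow> (\<integral>x. f p x \<partial>N)"
  proof (rule integral_dominated_convergence[OF _ F_meas abs_int _ dominated])
    show "AE x in N. (\<lambda>k. F k x) \<longlonglongrightarrow> f p x"
      using cont dom by eventually_elim (rule lim)
  qed (use fp in simp)
  then have "\<forall>\<^sub>F k in sequentially. (\<integral>x. F k x \<partial>N) < (\<integral>x. f p x \<partial>N) + \<delta>"
    by (rule order_tendstoD) (use \<delta> in simp)
  then obtain k where k: "(\<integral>x. F k x \<partial>N) < (\<integral>x. f p x \<partial>N) + \<delta>"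
    by (auto simp: eventually_sequentially)
  have "AE x in N. \<forall>q\<in>U k. f q x \<le> F k x"
    using cont dom by eventually_elim (blast intro: above)
  with k FI U show ?thesis by (intro exI conjI)
qed

section \<open>Consistency of maximisers of the contrast\<close>

text \<open>The statistical content of both models: a family of density ratios with respect to \<open>P\<close>, of which only the
  true one \<open>a s\<close> is required to be a probability density. The free normalisation \<open>\<nu>\<close> is part of the
  parameter, so the other \<open>a q\<close> can have any finite total mass.\<close>
locale tilted_family =
  fixes P :: "'x measure"
    and a :: "'p::{metric_space, second_countable_topology} \<Rightarrow> 'x \<Rightarrow> real"
    and \<Xi> :: "'p set" and s :: 'p
  assumes open_param: "open \<Xi>" and truth: "s \<in> \<Xi>"
    and a_nonneg: "\<And>q x. q \<in> \<Xi> \<Longrightarrow> x \<in> space P \<Longrightarrow> 0 \<le> a q x"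
    and a_int: "\<And>q. q \<in> \<Xi> \<Longrightarrow> integrable P (a q)"
    and a_cont: "AE x in P. continuous_on \<Xi> (\<lambda>q. a q x)"
    and a_ident: "\<And>q. q \<in> \<Xi> \<Longrightarrow> (AE x in P. a q x = a s x) \<Longrightarrow> q = s"
    and a_dom: "\<And>q. q \<in> \<Xi> \<Longrightarrow> \<exists>V S. open V \<and> q \<in> V \<and> integrable (density P (a s)) S \<and>
      (AE x in density P (a s). \<forall>q'\<in>V \<inter> \<Xi>. trunc_ln (a q' x / a s x) \<le> S x)"
    and prob_truth: "prob_space (density P (a s))"
begin

definition "Q = density P (a s)"

definition "gain c q x = trunc_ln (saturate c (a q x) / saturate c (a s x))"

sublocale Q: prob_space Q
  unfolding Q_def by (rule prob_truth)

lemma sets_Q [measurable_cong, simp]: "sets Q = sets P"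
  by (simp add: Q_def)

lemma space_Q [simp]: "space Q = space P"
  by (simp add: Q_def)

lemma measurable_a: "q \<in> \<Xi> \<Longrightarrow> a q \<in> borel_measurable P"
  using a_int by blast

lemma measurable_gain: "q \<in> \<Xi> \<Longrightarrow> gain c q \<in> borel_measurable P"
  using measurable_a[of q] measurable_a[OF truth] unfolding gain_def by measurable

lemma AE_Q_iff: "(AE x in Q. R x) \<longleftrightarrow> (AE x in P. 0 < a s x \<longrightarrow> R x)"
  using measurable_a[OF truth] unfolding Q_def by (subst AE_density) auto

lemma AE_P_imp_AE_Q:
  assumes "AE x in P. R x"
  shows "AE x in Q. R x"
  unfolding AE_Q_iff using assms by eventually_elim auto

lemma AE_Q_pos: "AE x in Q. 0 < a s x"
  unfolding AE_Q_iff by simp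

lemma gain_dominated:
  assumes q: "q \<in> \<Xi>" and c: "0 \<le> c"
  shows "\<exists>V S. open V \<and> q \<in> V \<and> V \<subseteq> \<Xi> \<and> integrable Q S \<and>
    (AE x in Q. \<forall>q'\<in>V. gain c q' x \<le> S x)"
proof -
  obtain V S where V: "open V" "q \<in> V" and S: "integrable Q S"
    and dom: "AE x in Q. \<forall>q'\<in>V \<inter> \<Xi>. trunc_ln (a q' x / a s x) \<le> S x"
    using a_dom[OF q] unfolding Q_def by blast
  have "AE x in Q. \<forall>q'\<in>V \<inter> \<Xi>. gain c q' x \<le> max 0 (S x)"
    using dom AE_Q_pos AE_space
  proof eventually_elim
    case (elim x)
    show ?case
    proof
      fix q' assume q': "q' \<in> V \<inter> \<Xi>"
      have "gain c q' x \<le> trunc_ln (max 1 (a q' x / a s x))"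
        unfolding gain_def using elim q' c by (intro trunc_ln_mono saturate_ratio_le a_nonneg) auto
      also have "\<dots> \<le> max 0 (trunc_ln (a q' x / a s x))"
        using trunc_ln_le[of 1] by (auto simp: max_def)
      also have "\<dots> \<le> max 0 (S x)"
        using elim q' by (intro max.mono) auto
      finally show "gain c q' x \<le> max 0 (S x)" .
    qed
  qed
  moreover have "integrable Q (\<lambda>x. max 0 (S x))" using S by auto
  ultimately show ?thesis
    using V q open_param by (intro exI[of _ "V \<inter> \<Xi>"] exI[of _ "\<lambda>x. max 0 (S x)"]) auto
qed

lemma integrable_gain:
  assumes q: "q \<in> \<Xi>" and c: "0 \<le> c"
  shows "integrable Q (gain c q)"
proof -
  obtain V S where V: "q \<in> V" and S: "integrable Q S"
    and dom: "AE x in Q. \<forall>q'\<in>V. gain c q' x \<le> S x"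
    using gain_dominated[OF q c] by blast
  show ?thesis
  proof (rule Bochner_Integration.integrable_bound)
    show "integrable Q (\<lambda>x. 2 + \<bar>S x\<bar>)" using S by auto
    show "gain c q \<in> borel_measurable Q"
      using measurable_gain[OF q] by simp
    show "AE x in Q. norm (gain c q x) \<le> norm (2 + \<bar>S x\<bar>)"
      using dom
    proof eventually_elim
      case (elim x)
      then show ?case
        using V trunc_ln_ge[of "saturate c (a q x) / saturate c (a s x)"] by (force simp: gain_def)
    qed
  qed
qed

lemma integrable_penalty:
  assumes q: "q \<in> \<Xi>" and c: "0 \<le> c"
  shows "integrable P (\<lambda>x. penalty c (a q x))"
proof (rule Bochner_Integration.integrable_bound[OF a_int[OF q]])
  show "(\<lambda>x. penalty c (a q x)) \<in> borel_measurable P"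
    using measurable_a[OF q] by measurable
  show "AE x in P. norm (penalty c (a q x)) \<le> norm (a q x)"
    using AE_space by eventually_elim (use q c a_nonneg penalty_nonneg penalty_le in force)
qed

text \<open>Rewritten as one integral with respect to \<open>P\<close>, the limiting contrast has a nonpositive integrand that
  vanishes only where \<open>a q = a s\<close>; identifiability excludes that it vanishes almost everywhere.\<close>
lemma gap:
  assumes q: "q \<in> \<Xi>" "q \<noteq> s" and c: "0 \<le> c"
  shows "(\<integral>x. gain c q x \<partial>Q) + (\<integral>x. penalty c (a s x) - penalty c (a q x) \<partial>P) < 0"
proof -
  note [measurable] = measurable_a[OF truth] measurable_gain[OF q(1)]
  let ?I = "\<lambda>x. a s x * gain c q x + (penalty c (a s x) - penalty c (a q x))"
  have nonneg: "AE x in P. 0 \<le> a s x"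
    using AE_space by eventually_elim (rule a_nonneg[OF truth])
  have gain_P: "integrable P (\<lambda>x. a s x * gain c q x)"
      "(\<integral>x. gain c q x \<partial>Q) = (\<integral>x. a s x * gain c q x \<partial>P)"
    using integrable_gain[OF q(1) c] nonneg
    by (simp_all add: Q_def integrable_density integral_density)
  have pens: "integrable P (\<lambda>x. penalty c (a s x) - penalty c (a q x))"
    using integrable_penalty q truth c by auto
  have I: "integrable P ?I" using gain_P pens by auto
  have le: "AE x in P. 0 \<le> - ?I x"
    using AE_space
  proof eventually_elim
    case (elim x)
    from contrast_le[OF c a_nonneg[OF truth elim] a_nonneg[OF q(1) elim]]
    show ?case by (simp add: gain_def)
  qed
  have "(\<integral>x. - ?I x \<partial>P) \<noteq> 0"
  proof
    assume "(\<integral>x. - ?I x \<partial>P) = 0"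
    then have "AE x in P. - ?I x = 0"
      using integral_nonneg_eq_0_iff_AE[OF Bochner_Integration.integrable_minus[OF I] le] by blast
    then have "AE x in P. a q x = a s x"
      using AE_space
    proof eventually_elim
      case (elim x)
      then show ?case
        using contrast_eqD[OF c a_nonneg[OF truth elim(2)] a_nonneg[OF q(1) elim(2)]]
        by (simp add: gain_def)
    qed
    with a_ident q show False by blast
  qed
  moreover have "0 \<le> (\<integral>x. - ?I x \<partial>P)" using le by (rule integral_nonneg_AE)
  moreover have "(\<integral>x. - ?I x \<partial>P) = - ((\<integral>x. gain c q x \<partial>Q) + (\<integral>x. penalty c (a s x) - penalty c (a q x) \<partial>P))"
    unfolding Bochner_Integration.integral_minus gain_P(2)
      Bochner_Integration.integral_add[OF gain_P(1) pens] ..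
  ultimately show ?thesis by linarith
qed

lemma gain_envelope:
  assumes q: "q \<in> \<Xi>" and c: "0 \<le> c" and \<delta>: "0 < \<delta>"
  shows "\<exists>U F. open U \<and> q \<in> U \<and> U \<subseteq> \<Xi> \<and> integrable Q F \<and>
    (AE x in Q. \<forall>q'\<in>U. gain c q' x \<le> F x) \<and> (\<integral>x. F x \<partial>Q) < (\<integral>x. gain c q x \<partial>Q) + \<delta>"
proof -
  obtain V S where V: "open V" "q \<in> V" "V \<subseteq> \<Xi>" and S: "integrable Q S"
    and dom: "AE x in Q. \<forall>q'\<in>V. gain c q' x \<le> S x"
    using gain_dominated[OF q c] by blast
  have "\<exists>U F. open U \<and> q \<in> U \<and> U \<subseteq> V \<and> integrable Q F \<and>
    (AE x in Q. \<forall>q'\<in>U. gain c q' x \<le> F x) \<and> (\<integral>x. F x \<partial>Q) < (\<integral>x. gain c q x \<partial>Q) + \<delta>"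
  proof (rule upper_envelope[OF V(1,2) _ integrable_gain[OF q c] S _ dom \<delta>])
    show "gain c q' \<in> borel_measurable Q" if "q' \<in> V" for q'
      using measurable_gain[of q' c] that V by auto
    show "AE x in Q. continuous_on V (\<lambda>q. gain c q x)"
      using AE_P_imp_AE_Q[OF a_cont] AE_Q_pos AE_space
    proof eventually_elim
      case (elim x)
      have "0 < saturate c (a s x)"
        using elim one_plus_pos[OF c, of "a s x"] by (simp add: saturate_def)
      moreover have "continuous_on V (\<lambda>q. saturate c (a q x))"
        using elim V by (intro continuous_on_saturate c continuous_on_subset[OF elim(1)] a_nonneg) auto
      ultimately show ?case
        unfolding gain_def by (intro continuous_intros) auto
    qed
  qed
  with V show ?thesis by blast
qed

text \<open>The bound holds on the whole space and not only almost everywhere, because an ergodic process may visit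
  null sets of \<open>P\<close>. Setting the envelope to zero on the exceptional set achieves this, since the penalty
  is nonnegative.\<close>
lemma penalty_envelope:
  assumes q: "q \<in> \<Xi>" and c: "0 \<le> c" and \<delta>: "0 < \<delta>"
  shows "\<exists>U H. open U \<and> q \<in> U \<and> U \<subseteq> \<Xi> \<and> integrable P H \<and>
    (\<forall>x\<in>space P. \<forall>q'\<in>U. - penalty c (a q' x) \<le> H x) \<and>
    (\<integral>x. H x \<partial>P) < (\<integral>x. - penalty c (a q x) \<partial>P) + \<delta>"
proof -
  have "\<exists>U H. open U \<and> q \<in> U \<and> U \<subseteq> \<Xi> \<and> integrable P H \<and>
    (AE x in P. \<forall>q'\<in>U. - penalty c (a q' x) \<le> H x) \<and>
    (\<integral>x. H x \<partial>P) < (\<integral>x. - penalty c (a q x) \<partial>P) + \<delta>"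
  proof (rule upper_envelope[OF open_param q _ _ _ _ _ \<delta>])
    show "(\<lambda>x. - penalty c (a q x)) \<in> borel_measurable P" if "q \<in> \<Xi>" for q
      using measurable_a[OF that] by measurable
    show "integrable P (\<lambda>x. - penalty c (a q x))" using integrable_penalty[OF q c] by simp
    show "integrable P (\<lambda>_. 0 :: real)" by simp
    show "AE x in P. continuous_on \<Xi> (\<lambda>q. - penalty c (a q x))"
      using a_cont AE_space
      by eventually_elim (intro continuous_on_minus continuous_on_penalty c a_nonneg)
    show "AE x in P. \<forall>q\<in>\<Xi>. - penalty c (a q x) \<le> 0"
      using AE_space by eventually_elim (use penalty_nonneg c a_nonneg in auto)
  qed
  then obtain U H where U: "open U" "q \<in> U" "U \<subseteq> \<Xi>" and H: "integrable P H"
    and ae: "AE x in P. \<forall>q'\<in>U. - penalty c (a q' x) \<le> H x"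
    and less: "(\<integral>x. H x \<partial>P) < (\<integral>x. - penalty c (a q x) \<partial>P) + \<delta>"
    by blast
  obtain N where N: "{x \<in> space P. \<not> (\<forall>q'\<in>U. - penalty c (a q' x) \<le> H x)} \<subseteq> N" "N \<in> null_sets P"
    using ae by (auto elim!: AE_E2 simp: eventually_ae_filter)
  define H' where "H' x = (if x \<in> N then 0 else H x)" for x
  have [measurable]: "N \<in> sets P" "H \<in> borel_measurable P" using N H by auto
  have eq: "AE x in P. H x = H' x"
    using AE_not_in[OF N(2)] by eventually_elim (simp add: H'_def)
  have meas: "H' \<in> borel_measurable P" unfolding H'_def by measurable
  have "integrable P H'"
    using H integrable_cong_AE[OF _ meas eq] by simp
  moreover have "(\<integral>x. H' x \<partial>P) = (\<integral>x. H x \<partial>P)"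
    using integral_cong_AE[OF _ meas eq] by simp
  moreover have "\<forall>x\<in>space P. \<forall>q'\<in>U. - penalty c (a q' x) \<le> H' x"
    using N(1) U penalty_nonneg[OF c] a_nonneg unfolding H'_def by (auto split: if_splits)
  ultimately show ?thesis using U less by (intro exI[of _ U] exI[of _ H']) auto
qed

end

locale two_samples = tilted_family P a \<Xi> s + M: prob_space M
  for P :: "'x measure" and a :: "'p::{metric_space, second_countable_topology} \<Rightarrow> 'x \<Rightarrow> real"
    and \<Xi> s and M :: "'w measure" +
  fixes X Y :: "nat \<Rightarrow> 'w \<Rightarrow> 'x"
  assumes X_space: "\<And>j \<omega>. 1 \<le> j \<Longrightarrow> \<omega> \<in> space M \<Longrightarrow> X j \<omega> \<in> space P"
    and X_ergodic: "\<And>\<phi> :: 'x \<Rightarrow> real. integrable P \<phi> \<Longrightarrow>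
      AE \<omega> in M. (\<lambda>m. (\<Sum>j=1..m. \<phi> (X j \<omega>)) / real m) \<longlonglongrightarrow> (\<integral>x. \<phi> x \<partial>P)"
    and Y_indep: "M.indep_vars (\<lambda>_. P) Y {1..}"
    and Y_law: "\<And>i. 1 \<le> i \<Longrightarrow> distr M P (Y i) = density P (a s)"
begin

lemma AE_Y:
  assumes "AE x in Q. R x"
  shows "AE \<omega> in M. \<forall>i\<ge>1. R (Y i \<omega>)"
proof -
  have "AE \<omega> in M. R (Y i \<omega>)" if "1 \<le> i" for i
  proof (rule AE_distrD[of "Y i" M P])
    show "Y i \<in> measurable M P" using Y_indep that by (auto simp: M.indep_vars_def2)
    show "AE x in distr M P (Y i). R x" using assms unfolding Y_law[OF that] Q_def .
  qed
  then show ?thesis by (simp add: AE_all_countable)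
qed

text \<open>The weight \<open>w\<close> is for the ratio of \<open>m / n\<close> to its limit, and is \<open>1\<close> for importance sampling.\<close>
definition "contrast c (w::real) n m q \<omega> =
  (\<Sum>i=1..n. gain c q (Y i \<omega>)) / real n +
  w * ((\<Sum>j=1..m. penalty c (a s (X j \<omega>)) - penalty c (a q (X j \<omega>))) / real m)"

text \<open>The limiting contrast at \<open>q\<close> is split into four equal parts \<open>- \<delta>\<close>, of which three are given up: one on the
  averages over \<open>Y\<close>, and two on those over \<open>X\<close>, for the envelope and for the weighted average.\<close>
lemma contrast_locally_negative:
  assumes q: "q \<in> \<Xi>" "q \<noteq> s" and c: "0 \<le> c"
    and m: "filterlim m at_top sequentially" and w: "w \<longlonglongrightarrow> 1"
  shows "\<exists>U \<delta>. open U \<and> q \<in> U \<and> 0 < \<delta> \<and>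
    (AE \<omega> in M. \<forall>\<^sub>F n in sequentially. \<forall>q'\<in>U. contrast c (w n) n (m n) q' \<omega> < - \<delta>)"
proof -
  define \<delta> where "\<delta> = - ((\<integral>x. gain c q x \<partial>Q) + (\<integral>x. penalty c (a s x) - penalty c (a q x) \<partial>P)) / 4"
  have \<delta>: "0 < \<delta>" using gap[OF q c] by (simp add: \<delta>_def)
  have total: "(\<integral>x. gain c q x \<partial>Q) + (\<integral>x. penalty c (a s x) - penalty c (a q x) \<partial>P) = - 4 * \<delta>"
    by (simp add: \<delta>_def)
  obtain U F where U: "open U" "q \<in> U" "U \<subseteq> \<Xi>" and F: "integrable Q F"
    and F_ge: "AE x in Q. \<forall>q'\<in>U. gain c q' x \<le> F x"
    and F_less: "(\<integral>x. F x \<partial>Q) < (\<integral>x. gain c q x \<partial>Q) + \<delta>"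
    using gain_envelope[OF q(1) c \<delta>] by blast
  obtain U' H where U': "open U'" "q \<in> U'" "U' \<subseteq> \<Xi>" and H: "integrable P H"
    and H_ge: "\<forall>x\<in>space P. \<forall>q'\<in>U'. - penalty c (a q' x) \<le> H x"
    and H_less: "(\<integral>x. H x \<partial>P) < (\<integral>x. - penalty c (a q x) \<partial>P) + \<delta>"
    using penalty_envelope[OF q(1) c \<delta>] by blast
  define B where "B x = penalty c (a s x) + H x" for x
  have B: "integrable P B" unfolding B_def using H integrable_penalty[OF truth c] by auto
  have B_less: "(\<integral>x. B x \<partial>P) < (\<integral>x. penalty c (a s x) - penalty c (a q x) \<partial>P) + \<delta>"
    using H_less H integrable_penalty[OF truth c] integrable_penalty[OF q(1) c] by (simp add: B_def)
  have "AE \<omega> in M. \<forall>\<^sub>F n in sequentially. (\<Sum>i=1..n. F (Y i \<omega>)) / real n < (\<integral>x. gain c q x \<partial>Q) + \<delta>"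
  proof (rule M.strong_law_upper[OF Y_indep _ F F_less])
    show "distr M P (Y i) = Q" if "1 \<le> i" for i
      unfolding Q_def by (rule Y_law[OF that])
  qed
  then have "AE \<omega> in M. \<forall>\<^sub>F n in sequentially. \<forall>q'\<in>U \<inter> U'. contrast c (w n) n (m n) q' \<omega> < - \<delta>"
    using AE_Y[OF F_ge] X_ergodic[OF B] AE_space
  proof eventually_elim
    case (elim \<omega>)
    have "(\<lambda>n. w n * ((\<Sum>j=1..m n. B (X j \<omega>)) / real (m n))) \<longlonglongrightarrow> 1 * (\<integral>x. B x \<partial>P)"
      using filterlim_compose[OF elim(3) m] by (intro tendsto_mult w)
    then have "\<forall>\<^sub>F n in sequentially. w n * ((\<Sum>j=1..m n. B (X j \<omega>)) / real (m n))
        < (\<integral>x. penalty c (a s x) - penalty c (a q x) \<partial>P) + 2 * \<delta>"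
      by (rule order_tendstoD) (use B_less \<delta> in simp)
    moreover have "\<forall>\<^sub>F n in sequentially. 0 < w n"
      using w by (rule order_tendstoD) simp
    ultimately show ?case
      using elim(1)
    proof eventually_elim
      case (elim n)
      show ?case
      proof
        fix q' assume q': "q' \<in> U \<inter> U'"
        have "(\<Sum>i=1..n. gain c q' (Y i \<omega>)) / real n \<le> (\<Sum>i=1..n. F (Y i \<omega>)) / real n"
          using q' \<open>\<forall>i\<ge>1. \<forall>q'\<in>U. gain c q' (Y i \<omega>) \<le> F (Y i \<omega>)\<close>
          by (intro divide_right_mono sum_mono) auto
        moreover have "w n * ((\<Sum>j=1..m n. penalty c (a s (X j \<omega>)) - penalty c (a q' (X j \<omega>))) / real (m n))
            \<le> w n * ((\<Sum>j=1..m n. B (X j \<omega>)) / real (m n))"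
        proof (intro mult_left_mono divide_right_mono sum_mono)
          fix j assume "j \<in> {1..m n}"
          then have "X j \<omega> \<in> space P" using X_space \<open>\<omega> \<in> space M\<close> by simp
          then show "penalty c (a s (X j \<omega>)) - penalty c (a q' (X j \<omega>)) \<le> B (X j \<omega>)"
            using H_ge q' by (auto simp: B_def)
        qed (use elim in auto)
        ultimately show "contrast c (w n) n (m n) q' \<omega> < - \<delta>"
          using elim total \<delta> unfolding contrast_def by linarith
      qed
    qed
  qed
  moreover have "open (U \<inter> U')" "q \<in> U \<inter> U'" using U U' by auto
  ultimately show ?thesis using \<delta> by (intro exI conjI)
qed

text \<open>Wald's compactness argument: outside any ball around \<open>s\<close>, the compact set is covered by finitely many
  neighbourhoods on which the contrast is eventually bounded away from zero. A near-maximiser has a contrast of at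
  least \<open>- o(1)\<close> and so cannot stay in any of them.\<close>
theorem contrast_consistency:
  assumes c: "0 \<le> c"
    and m: "filterlim m at_top sequentially" and w: "w \<longlonglongrightarrow> 1"
    and K: "compact K" "K \<subseteq> \<Xi>" "AE \<omega> in M. \<forall>n\<ge>1. \<xi> n \<omega> \<in> K"
    and near_max: "AE \<omega> in M. \<exists>e. e \<longlonglongrightarrow> 0 \<and>
      (\<forall>\<^sub>F n in sequentially. - e n \<le> contrast c (w n) n (m n) (\<xi> n \<omega>) \<omega>)"
  shows "AE \<omega> in M. (\<lambda>n. \<xi> n \<omega>) \<longlonglongrightarrow> s"
proof -
  have avoid: "\<exists>U. open U \<and> q \<in> U \<and> (AE \<omega> in M. \<forall>\<^sub>F n in sequentially. \<xi> n \<omega> \<notin> U)"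
    if q: "q \<in> K - {s}" for q
  proof -
    have "q \<in> \<Xi>" "q \<noteq> s" using q K(2) by auto
    from contrast_locally_negative[OF this c m w]
    obtain U \<delta> where U: "open U" "q \<in> U" and \<delta>: "0 < \<delta>"
      and neg: "AE \<omega> in M. \<forall>\<^sub>F n in sequentially. \<forall>q'\<in>U. contrast c (w n) n (m n) q' \<omega> < - \<delta>"
      by (elim exE conjE)
    from neg near_max have "AE \<omega> in M. \<forall>\<^sub>F n in sequentially. \<xi> n \<omega> \<notin> U"
    proof eventually_elim
      case (elim \<omega>)
      then obtain e where e: "e \<longlonglongrightarrow> 0"
        "\<forall>\<^sub>F n in sequentially. - e n \<le> contrast c (w n) n (m n) (\<xi> n \<omega>) \<omega>" by blast
      have "\<forall>\<^sub>F n in sequentially. e n < \<delta>"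
        using e(1) by (rule order_tendstoD) (rule \<delta>)
      with elim(1) e(2) show ?case
      proof eventually_elim
        case (elim n)
        show ?case
        proof
          assume "\<xi> n \<omega> \<in> U"
          with elim(1) have "contrast c (w n) n (m n) (\<xi> n \<omega>) \<omega> < - \<delta>" by (rule bspec)
          with elim show False by linarith
        qed
      qed
    qed
    with U show ?thesis by (intro exI conjI)
  qed
  have "AE \<omega> in M. \<forall>\<^sub>F n in sequentially. \<xi> n \<omega> \<in> ball s (1 / real (Suc k))" for k
  proof -
    define C where "C = K - ball s (1 / real (Suc k))"
    have C: "compact C" unfolding C_def using K(1) by (intro compact_diff) auto
    have sub: "C \<subseteq> K - {s}" by (auto simp: C_def)
    define good where "good q U \<longleftrightarrow> open U \<and> q \<in> U \<and>
      (AE \<omega> in M. \<forall>\<^sub>F n in sequentially. \<xi> n \<omega> \<notin> U)" for q U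
    have "\<forall>q\<in>C. \<exists>U. good q U" using subsetD[OF sub, THEN avoid] unfolding good_def ..
    then obtain W where "\<forall>q\<in>C. good q (W q)" by (rule bchoice[THEN exE])
    then have W: "\<And>q. q \<in> C \<Longrightarrow> open (W q)" "\<And>q. q \<in> C \<Longrightarrow> q \<in> W q"
      "\<And>q. q \<in> C \<Longrightarrow> AE \<omega> in M. \<forall>\<^sub>F n in sequentially. \<xi> n \<omega> \<notin> W q"
      by (simp_all add: good_def)
    have "C \<subseteq> (\<Union>q\<in>C. W q)" using W(2) by blast
    then obtain D where D: "D \<subseteq> C" "finite D" "C \<subseteq> (\<Union>q\<in>D. W q)"
      using compactE_image[OF C, of C W] W(1) by metis
    have "AE \<omega> in M. \<forall>q\<in>D. \<forall>\<^sub>F n in sequentially. \<xi> n \<omega> \<notin> W q"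
      using D(1) W(3) by (intro AE_finite_allI[OF D(2)]) blast
    then show ?thesis
      using K(3)
    proof eventually_elim
      case (elim \<omega>)
      have "\<forall>\<^sub>F n in sequentially. \<forall>q\<in>D. \<xi> n \<omega> \<notin> W q"
        using elim(1) D(2) by (simp add: eventually_ball_finite)
      then show ?case
        using eventually_ge_at_top[of 1]
      proof eventually_elim
        case (elim n)
        then show ?case using D(3) \<open>\<forall>n\<ge>1. \<xi> n \<omega> \<in> K\<close> by (auto simp: C_def)
      qed
    qed
  qed
  then have "AE \<omega> in M. \<forall>k. \<forall>\<^sub>F n in sequentially. \<xi> n \<omega> \<in> ball s (1 / real (Suc k))"
    by (simp add: AE_all_countable)
  then show ?thesis
  proof eventually_elim
    case (elim \<omega>)
    show ?case
    proof (rule tendstoI)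
      fix r :: real assume "0 < r"
      then obtain k where k: "1 / real (Suc k) < r" using nat_approx_posE by blast
      show "\<forall>\<^sub>F n in sequentially. dist (\<xi> n \<omega>) s < r"
        using elim[rule_format, of k] by eventually_elim (use k in \<open>auto simp: dist_commute\<close>)
    qed
  qed
qed

end

section \<open>From the two objectives to the contrast\<close>

text \<open>A single vanishing density ratio among the observations sends the whole objective to \<open>- \<infinity>\<close>. Near-maximisers
  avoid this, since the objective is finite at the truth.\<close>
lemma sum_elog:
  "finite I \<Longrightarrow> (\<Sum>i\<in>I. elog (u i)) = (if \<forall>i\<in>I. 0 < u i then ereal (\<Sum>i\<in>I. ln (u i)) else - \<infinity>)"
  by (induction I rule: finite_induct) (auto simp: elog_def zero_ereal_def)

lemma approx_maximiserD:
  assumes "approx_maximiser M \<Xi> L \<xi>" "s \<in> \<Xi>"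
  shows "AE \<omega> in M. \<exists>e. e \<longlonglongrightarrow> 0 \<and>
    (\<forall>\<^sub>F n in sequentially. L n \<omega> s - ereal (e n) \<le> L n \<omega> (\<xi> n \<omega>))"
  using assms(1) unfolding approx_maximiser_def
proof eventually_elim
  case (elim \<omega>)
  then obtain e where e: "e \<longlonglongrightarrow> 0"
    "\<forall>\<^sub>F n in sequentially. (SUP q\<in>\<Xi>. L n \<omega> q) - ereal (e n) \<le> L n \<omega> (\<xi> n \<omega>)" by blast
  from e(2) have "\<forall>\<^sub>F n in sequentially. L n \<omega> s - ereal (e n) \<le> L n \<omega> (\<xi> n \<omega>)"
  proof eventually_elim
    case (elim n)
    have "L n \<omega> s - ereal (e n) \<le> (SUP q\<in>\<Xi>. L n \<omega> q) - ereal (e n)"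
      using assms(2) by (intro ereal_minus_mono SUP_upper) auto
    with elim show ?case by (rule order_trans[rotated])
  qed
  with e(1) show ?case by blast
qed

context two_samples
begin

text \<open>Real versions of the two objectives, to be used when all density ratios at the observations are positive.\<close>
definition "IS_obj n m q \<omega> =
  (\<Sum>i=1..n. ln (a q (Y i \<omega>))) / real n - (\<Sum>j=1..m. a q (X j \<omega>)) / real m"

definition "NCE_obj n m q \<omega> =
  (\<Sum>i=1..n. ln (real n / real m * saturate (real n / real m) (a q (Y i \<omega>)))) / real n
  - (\<Sum>j=1..m. ln (1 + real n / real m * a q (X j \<omega>))) / real n"

lemma ln_le_gain:
  assumes "0 < a q x" "0 < a s x" "0 \<le> c"
  shows "ln (saturate c (a q x)) - ln (saturate c (a s x)) \<le> gain c q x"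
proof -
  have "0 < saturate c (a q x)" "0 < saturate c (a s x)"
    using assms one_plus_pos[of c] by (auto simp: saturate_def)
  then show ?thesis
    using ln_le_trunc_ln[of "saturate c (a q x) / saturate c (a s x)"] by (simp add: gain_def ln_div)
qed

lemma IS_obj_diff_le:
  assumes pos: "\<forall>i\<in>{1..n}. 0 < a q (Y i \<omega>)" "\<forall>i\<in>{1..n}. 0 < a s (Y i \<omega>)"
  shows "IS_obj n m q \<omega> - IS_obj n m s \<omega> \<le> contrast 0 1 n m q \<omega>"
proof -
  have "(\<Sum>i=1..n. ln (a q (Y i \<omega>)) - ln (a s (Y i \<omega>))) \<le> (\<Sum>i=1..n. gain 0 q (Y i \<omega>))"
    using pos ln_le_gain[where c = 0] by (intro sum_mono) (auto simp: saturate_def)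
  then have "(\<Sum>i=1..n. ln (a q (Y i \<omega>)) - ln (a s (Y i \<omega>))) / real n
      \<le> (\<Sum>i=1..n. gain 0 q (Y i \<omega>)) / real n"
    by (intro divide_right_mono) auto
  then show ?thesis
    by (simp add: IS_obj_def contrast_def penalty_def sum_subtractf diff_divide_distrib)
qed

text \<open>Replacing the sample-size ratio \<open>n / m\<close> by \<open>c\<close> costs at most \<open>\<bar>ln (n / m / c)\<bar>\<close> for each logarithm
  of the form \<open>ln (1 + r u)\<close>. Two of these occur per data point.\<close>
lemma NCE_obj_diff_le:
  assumes pos: "\<forall>i\<in>{1..n}. 0 < a q (Y i \<omega>)" "\<forall>i\<in>{1..n}. 0 < a s (Y i \<omega>)"
    and q: "q \<in> \<Xi>" and \<omega>: "\<omega> \<in> space M" and n: "0 < n" and m: "0 < m" and c: "0 < c"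
  shows "NCE_obj n m q \<omega> - NCE_obj n m s \<omega> \<le> contrast c (c * real m / real n) n m q \<omega>
    + 2 * \<bar>ln (real n / real m / c)\<bar> * (1 + real m / real n)"
proof -
  define r where "r = real n / real m"
  define \<eta> where "\<eta> = \<bar>ln (r / c)\<bar>"
  have r: "0 < r" using n m by (simp add: r_def)
  have c0: "0 \<le> c" using c by simp
  have scale: "\<bar>ln (1 + r * u) - ln (1 + c * u)\<bar> \<le> \<eta>" if "0 \<le> u" for u
    unfolding \<eta>_def using c r that by (rule ln_one_plus_scale)
  have ln_saturate: "ln (saturate d u) = ln u - ln (1 + d * u)" if "0 < u" "0 < d" for d u
    using that one_plus_pos[of d u] by (simp add: saturate_def ln_div)
  have ln_prob: "ln (r * saturate r u) = ln r + ln u - ln (1 + r * u)" if "0 < u" for u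
  proof -
    have "0 < saturate r u" using that r one_plus_pos[of r u] by (simp add: saturate_def)
    then show ?thesis using ln_saturate[OF that r] r by (simp add: ln_mult_pos)
  qed
  have Yterm: "ln (r * saturate r (a q (Y i \<omega>))) - ln (r * saturate r (a s (Y i \<omega>))) \<le> gain c q (Y i \<omega>) + 2 * \<eta>"
    if "i \<in> {1..n}" for i
  proof -
    have p: "0 < a q (Y i \<omega>)" "0 < a s (Y i \<omega>)" using pos that by auto
    show ?thesis
      using scale[of "a q (Y i \<omega>)"] scale[of "a s (Y i \<omega>)"] ln_le_gain[OF p c0]
        ln_prob[OF p(1)] ln_prob[OF p(2)] ln_saturate[OF p(1) c] ln_saturate[OF p(2) c] p
      by linarith
  qed
  have Xterm: "ln (1 + r * a s (X j \<omega>)) - ln (1 + r * a q (X j \<omega>))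
      \<le> c * (penalty c (a s (X j \<omega>)) - penalty c (a q (X j \<omega>))) + 2 * \<eta>"
    if "j \<in> {1..m}" for j
  proof -
    have p: "0 \<le> a q (X j \<omega>)" "0 \<le> a s (X j \<omega>)"
      using that X_space[of j \<omega>] \<omega> by (auto intro!: a_nonneg q truth)
    have "c * (penalty c (a s (X j \<omega>)) - penalty c (a q (X j \<omega>)))
        = ln (1 + c * a s (X j \<omega>)) - ln (1 + c * a q (X j \<omega>))"
      using c by (simp add: penalty_def right_diff_distrib)
    then show ?thesis
      using scale[OF p(1)] scale[OF p(2)] by linarith
  qed
  have "(\<Sum>i=1..n. ln (r * saturate r (a q (Y i \<omega>))) - ln (r * saturate r (a s (Y i \<omega>)))) / real n
      \<le> (\<Sum>i=1..n. gain c q (Y i \<omega>) + 2 * \<eta>) / real n"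
    by (intro divide_right_mono sum_mono Yterm) auto
  also have "\<dots> = (\<Sum>i=1..n. gain c q (Y i \<omega>)) / real n + 2 * \<eta>"
    using n by (simp add: sum.distrib add_divide_distrib)
  finally have 1: "(\<Sum>i=1..n. ln (r * saturate r (a q (Y i \<omega>))) - ln (r * saturate r (a s (Y i \<omega>)))) / real n
      \<le> (\<Sum>i=1..n. gain c q (Y i \<omega>)) / real n + 2 * \<eta>" .
  define T where "T = (\<Sum>j=1..m. penalty c (a s (X j \<omega>)) - penalty c (a q (X j \<omega>)))"
  have "(\<Sum>j=1..m. ln (1 + r * a s (X j \<omega>)) - ln (1 + r * a q (X j \<omega>))) / real n
      \<le> (\<Sum>j=1..m. c * (penalty c (a s (X j \<omega>)) - penalty c (a q (X j \<omega>))) + 2 * \<eta>) / real n"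
    by (intro divide_right_mono sum_mono Xterm) auto
  also have "\<dots> = (c * T + real m * (2 * \<eta>)) / real n"
    unfolding sum.distrib sum_distrib_left[symmetric] T_def by simp
  also have "\<dots> = c * real m / real n * (T / real m) + 2 * \<eta> * (real m / real n)"
    using n m by (simp add: field_simps)
  finally have 2: "(\<Sum>j=1..m. ln (1 + r * a s (X j \<omega>)) - ln (1 + r * a q (X j \<omega>))) / real n
      \<le> c * real m / real n * (T / real m) + 2 * \<eta> * (real m / real n)" .
  have "NCE_obj n m q \<omega> - NCE_obj n m s \<omega> =
      (\<Sum>i=1..n. ln (r * saturate r (a q (Y i \<omega>))) - ln (r * saturate r (a s (Y i \<omega>)))) / real n
      + (\<Sum>j=1..m. ln (1 + r * a s (X j \<omega>)) - ln (1 + r * a q (X j \<omega>))) / real n"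
    unfolding NCE_obj_def r_def[symmetric] by (simp add: sum_subtractf diff_divide_distrib)
  with 1 2 show ?thesis
    unfolding contrast_def T_def[symmetric] r_def[symmetric] \<eta>_def[symmetric]
    by (simp only: distrib_left mult_1_right)
qed

text \<open>At the truth all density ratios of the observations are almost surely positive. So the objective there is
  finite, and the near-maximisers inherit finiteness from it.\<close>
lemma near_maximiser_real:
  assumes approx: "approx_maximiser M \<Xi> L \<xi>"
    and L: "\<And>n \<omega> q. 1 \<le> n \<Longrightarrow> \<omega> \<in> space M \<Longrightarrow> q \<in> \<Xi> \<Longrightarrow>
      L n \<omega> q = (if \<forall>i\<in>{1..n}. 0 < a q (Y i \<omega>) then ereal (J n q \<omega>) else - \<infinity>)"
    and mem: "AE \<omega> in M. \<forall>n\<ge>1. \<xi> n \<omega> \<in> \<Xi>"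
  shows "AE \<omega> in M. \<exists>e. e \<longlonglongrightarrow> 0 \<and> (\<forall>\<^sub>F n in sequentially.
    (\<forall>i\<in>{1..n}. 0 < a (\<xi> n \<omega>) (Y i \<omega>)) \<and> (\<forall>i\<in>{1..n}. 0 < a s (Y i \<omega>)) \<and>
    - e n \<le> J n (\<xi> n \<omega>) \<omega> - J n s \<omega>)"
  using approx_maximiserD[OF approx truth] AE_Y[OF AE_Q_pos] mem AE_space
proof eventually_elim
  case (elim \<omega>)
  then obtain e where e: "e \<longlonglongrightarrow> 0"
    "\<forall>\<^sub>F n in sequentially. L n \<omega> s - ereal (e n) \<le> L n \<omega> (\<xi> n \<omega>)" by blast
  have "\<forall>\<^sub>F n in sequentially.
    (\<forall>i\<in>{1..n}. 0 < a (\<xi> n \<omega>) (Y i \<omega>)) \<and> (\<forall>i\<in>{1..n}. 0 < a s (Y i \<omega>)) \<and>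
    - e n \<le> J n (\<xi> n \<omega>) \<omega> - J n s \<omega>"
    using e(2) eventually_ge_at_top[of 1]
  proof eventually_elim
    case (elim n)
    have pos: "\<forall>i\<in>{1..n}. 0 < a s (Y i \<omega>)" using \<open>\<forall>i\<ge>1. 0 < a s (Y i \<omega>)\<close> by simp
    then have Ls: "L n \<omega> s = ereal (J n s \<omega>)"
      using L[of n \<omega> s] elim(2) \<open>\<omega> \<in> space M\<close> truth by simp
    have "\<xi> n \<omega> \<in> \<Xi>" using \<open>\<forall>n\<ge>1. \<xi> n \<omega> \<in> \<Xi>\<close> elim(2) by simp
    note L\<xi> = L[OF elim(2) \<open>\<omega> \<in> space M\<close> this]
    show ?case
      using elim(1) pos unfolding Ls L\<xi> by (auto split: if_splits)
  qed
  with e(1) show ?case by blast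
qed

theorem IS_consistency:
  assumes K: "compact K" "K \<subseteq> \<Xi>" "AE \<omega> in M. \<forall>n\<ge>1. \<xi> n \<omega> \<in> K"
    and m: "filterlim m at_top sequentially"
    and near_max: "AE \<omega> in M. \<exists>e. e \<longlonglongrightarrow> 0 \<and> (\<forall>\<^sub>F n in sequentially.
      (\<forall>i\<in>{1..n}. 0 < a (\<xi> n \<omega>) (Y i \<omega>)) \<and> (\<forall>i\<in>{1..n}. 0 < a s (Y i \<omega>)) \<and>
      - e n \<le> IS_obj n (m n) (\<xi> n \<omega>) \<omega> - IS_obj n (m n) s \<omega>)"
  shows "AE \<omega> in M. (\<lambda>n. \<xi> n \<omega>) \<longlonglongrightarrow> s"
proof (rule contrast_consistency[OF _ m tendsto_const K])
  show "AE \<omega> in M. \<exists>e. e \<longlonglongrightarrow> 0 \<and>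
      (\<forall>\<^sub>F n in sequentially. - e n \<le> contrast 0 1 n (m n) (\<xi> n \<omega>) \<omega>)"
    using near_max
  proof eventually_elim
    case (elim \<omega>)
    then obtain e where e: "e \<longlonglongrightarrow> 0" and ev: "\<forall>\<^sub>F n in sequentially.
      (\<forall>i\<in>{1..n}. 0 < a (\<xi> n \<omega>) (Y i \<omega>)) \<and> (\<forall>i\<in>{1..n}. 0 < a s (Y i \<omega>)) \<and>
      - e n \<le> IS_obj n (m n) (\<xi> n \<omega>) \<omega> - IS_obj n (m n) s \<omega>" by blast
    from ev have "\<forall>\<^sub>F n in sequentially. - e n \<le> contrast 0 1 n (m n) (\<xi> n \<omega>) \<omega>"
    proof eventually_elim
      case (elim n)
      then show ?case
        using IS_obj_diff_le[of n "\<xi> n \<omega>" \<omega> "m n"] by linarith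
    qed
    with e show ?case by blast
  qed
qed simp

text \<open>The contrast with \<open>c = 1 / \<tau>\<close> is the limit of the objective, and the weight is
  \<open>m / (n \<tau>)\<close>, which tends to \<open>1\<close>.\<close>
theorem NCE_consistency:
  assumes K: "compact K" "K \<subseteq> \<Xi>" "AE \<omega> in M. \<forall>n\<ge>1. \<xi> n \<omega> \<in> K"
    and m: "filterlim m at_top sequentially" "\<forall>n\<ge>1. 0 < m n"
    and tau: "0 < \<tau>" "(\<lambda>n. real (m n) / real n) \<longlonglongrightarrow> \<tau>"
    and near_max: "AE \<omega> in M. \<exists>e. e \<longlonglongrightarrow> 0 \<and> (\<forall>\<^sub>F n in sequentially.
      (\<forall>i\<in>{1..n}. 0 < a (\<xi> n \<omega>) (Y i \<omega>)) \<and> (\<forall>i\<in>{1..n}. 0 < a s (Y i \<omega>)) \<and>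
      - e n \<le> NCE_obj n (m n) (\<xi> n \<omega>) \<omega> - NCE_obj n (m n) s \<omega>)"
  shows "AE \<omega> in M. (\<lambda>n. \<xi> n \<omega>) \<longlonglongrightarrow> s"
proof (rule contrast_consistency[OF _ m(1) _ K])
  define err where "err n = 2 * \<bar>ln (real n / real (m n) / (1 / \<tau>))\<bar> * (1 + real (m n) / real n)" for n
  have "(\<lambda>n. inverse (real (m n) / real n) / (1 / \<tau>)) \<longlonglongrightarrow> inverse \<tau> / (1 / \<tau>)"
    using tau by (intro tendsto_intros) auto
  then have "(\<lambda>n. real n / real (m n) / (1 / \<tau>)) \<longlonglongrightarrow> 1"
    using tau(1) by (simp add: field_simps)
  then have "(\<lambda>n. 2 * \<bar>ln (real n / real (m n) / (1 / \<tau>))\<bar> * (1 + real (m n) / real n))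
      \<longlonglongrightarrow> 2 * \<bar>ln 1\<bar> * (1 + \<tau>)"
    by (intro tendsto_intros tau(2)) simp_all
  then have err: "err \<longlonglongrightarrow> 0" by (simp add: err_def[abs_def])
  show "(\<lambda>n. 1 / \<tau> * real (m n) / real n) \<longlonglongrightarrow> 1"
    using tendsto_mult_left[OF tau(2), of "1 / \<tau>"] tau(1) by simp
  show "0 \<le> 1 / \<tau>" using tau(1) by simp
  show "AE \<omega> in M. \<exists>e. e \<longlonglongrightarrow> 0 \<and>
      (\<forall>\<^sub>F n in sequentially. - e n \<le> contrast (1 / \<tau>) (1 / \<tau> * real (m n) / real n) n (m n) (\<xi> n \<omega>) \<omega>)"
    using near_max K(3) AE_space
  proof eventually_elim
    case (elim \<omega>)
    then obtain e where e: "e \<longlonglongrightarrow> 0" and ev: "\<forall>\<^sub>F n in sequentially.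
      (\<forall>i\<in>{1..n}. 0 < a (\<xi> n \<omega>) (Y i \<omega>)) \<and> (\<forall>i\<in>{1..n}. 0 < a s (Y i \<omega>)) \<and>
      - e n \<le> NCE_obj n (m n) (\<xi> n \<omega>) \<omega> - NCE_obj n (m n) s \<omega>" by blast
    have "(\<lambda>n. e n + err n) \<longlonglongrightarrow> 0" using tendsto_add[OF e err] by simp
    moreover have "\<forall>\<^sub>F n in sequentially. - (e n + err n)
        \<le> contrast (1 / \<tau>) (1 / \<tau> * real (m n) / real n) n (m n) (\<xi> n \<omega>) \<omega>"
      using ev eventually_ge_at_top[of 1]
    proof eventually_elim
      case (elim n)
      have q: "\<xi> n \<omega> \<in> \<Xi>" using \<open>\<forall>n\<ge>1. \<xi> n \<omega> \<in> K\<close> elim(2) K(2) by blast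
      have nm: "0 < n" "0 < m n" "0 < 1 / \<tau>" using elim(2) m(2) tau(1) by auto
      have pos: "\<forall>i\<in>{1..n}. 0 < a (\<xi> n \<omega>) (Y i \<omega>)" "\<forall>i\<in>{1..n}. 0 < a s (Y i \<omega>)"
        using elim(1) by blast+
      from elim(1) NCE_obj_diff_le[OF pos q \<open>\<omega> \<in> space M\<close> nm] show ?case
        unfolding err_def by linarith
    qed
    ultimately show ?case by blast
  qed
qed

end

lemma lik_IS_eq:
  assumes n: "0 < n"
  shows "lik_IS h g y x n m (\<theta>, \<nu>) =
    (if \<forall>i\<in>{1..n}. 0 < exp \<nu> * (h \<theta> (y i) / g (y i))
     then ereal ((\<Sum>i=1..n. ln (exp \<nu> * (h \<theta> (y i) / g (y i)))) / real n
       - (\<Sum>j=1..m. exp \<nu> * (h \<theta> (x j) / g (x j))) / real m)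
     else - \<infinity>)"
proof -
  let ?r = "\<lambda>i. h \<theta> (y i) / g (y i)"
  have pos_iff: "(\<forall>i\<in>{1..n}. 0 < exp \<nu> * ?r i) \<longleftrightarrow> (\<forall>i\<in>{1..n}. 0 < ?r i)"
    by (simp add: zero_less_mult_iff del: times_divide_eq_right)
  show ?thesis
  proof (cases "\<forall>i\<in>{1..n}. 0 < ?r i")
    case True
    have "(\<Sum>i=1..n. ln (exp \<nu> * ?r i)) = (\<Sum>i=1..n. ln (?r i) + \<nu>)"
      using True by (intro sum.cong) (auto simp: ln_mult_pos simp del: times_divide_eq_right)
    then have "(\<Sum>i=1..n. ln (exp \<nu> * ?r i)) / real n = (\<Sum>i=1..n. ln (?r i)) / real n + \<nu>"
      using n by (simp add: sum.distrib add_divide_distrib)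
    with True show ?thesis
      unfolding pos_iff by (simp add: lik_IS_def sum_elog sum_distrib_left[symmetric] del: times_divide_eq_right)
  next
    case False
    have "(\<Sum>i=1..n. elog (?r i)) = - \<infinity>"
      using False by (simp only: sum_elog finite_atLeastAtMost if_False)
    then show ?thesis
      unfolding pos_iff if_not_P[OF False] using n by (simp add: lik_IS_def)
  qed
qed

lemma lik_NCE_eq:
  assumes n: "0 < n" and m: "0 < m"
    and nonneg: "\<And>i. i \<in> {1..n} \<Longrightarrow> 0 \<le> h \<theta> (y i)" "\<And>i. i \<in> {1..n} \<Longrightarrow> 0 \<le> g (y i)"
      "\<And>j. j \<in> {1..m} \<Longrightarrow> 0 \<le> h \<theta> (x j)" "\<And>j. j \<in> {1..m} \<Longrightarrow> 0 \<le> g (x j)"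
  shows "lik_NCE h g y x n m (\<theta>, \<nu>) =
    (if \<forall>i\<in>{1..n}. 0 < exp \<nu> * (h \<theta> (y i) / g (y i))
     then ereal ((\<Sum>i=1..n. ln (real n / real m * saturate (real n / real m) (exp \<nu> * (h \<theta> (y i) / g (y i))))) / real n
       - (\<Sum>j=1..m. ln (1 + real n / real m * (exp \<nu> * (h \<theta> (x j) / g (x j))))) / real n)
     else - \<infinity>)"
proof -
  define r where "r = real n / real m"
  have r: "0 < r" using n m by (simp add: r_def)
  define u where "u z = exp \<nu> * (h \<theta> z / g z)" for z
  have uy: "0 \<le> u (y i)" if "i \<in> {1..n}" for i using that nonneg by (simp add: u_def)
  have ux: "0 \<le> u (x j)" if "j \<in> {1..m}" for j using that nonneg by (simp add: u_def)
  have prob: "nce_prob h g n m (\<theta>, \<nu>) z = r * saturate r (u z)" if "0 \<le> h \<theta> z" "0 \<le> g z" for z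
    using nce_prob_eq[of h \<theta> z g n m \<nu>] that n m
    by (simp add: saturate_def u_def r_def mult_ac)
  have saturate_pos: "0 < saturate r v \<longleftrightarrow> 0 < v" if "0 \<le> v" for v
    using one_plus_pos[of r v] r that by (simp add: saturate_def zero_less_divide_iff)
  have "(\<Sum>j=1..m. elog (1 - nce_prob h g n m (\<theta>, \<nu>) (x j))) = (\<Sum>j=1..m. elog (1 / (1 + r * u (x j))))"
  proof (rule sum.cong)
    fix j assume j: "j \<in> {1..m}"
    have "0 < 1 + r * u (x j)" using one_plus_pos[OF _ ux[OF j], of r] r by simp
    then have "1 - r * saturate r (u (x j)) = 1 / (1 + r * u (x j))"
      by (simp add: saturate_def field_simps)
    then show "elog (1 - nce_prob h g n m (\<theta>, \<nu>) (x j)) = elog (1 / (1 + r * u (x j)))"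
      using prob[of "x j"] nonneg j by simp
  qed simp
  also have "\<dots> = ereal (- (\<Sum>j=1..m. ln (1 + r * u (x j))))"
  proof -
    have p: "0 < 1 + r * u (x j)" if "j \<in> {1..m}" for j
      using one_plus_pos[OF _ ux[OF that], of r] r by simp
    then have "(\<Sum>j=1..m. ln (1 / (1 + r * u (x j)))) = (\<Sum>j=1..m. - ln (1 + r * u (x j)))"
      by (intro sum.cong) (auto simp: ln_div)
    with p show ?thesis by (simp add: sum_elog sum_negf)
  qed
  finally have X: "(\<Sum>j=1..m. elog (1 - nce_prob h g n m (\<theta>, \<nu>) (x j)))
      = ereal (- (\<Sum>j=1..m. ln (1 + r * u (x j))))" .
  have Y: "(\<Sum>i=1..n. elog (nce_prob h g n m (\<theta>, \<nu>) (y i)))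
      = (if \<forall>i\<in>{1..n}. 0 < u (y i) then ereal (\<Sum>i=1..n. ln (r * saturate r (u (y i)))) else - \<infinity>)"
  proof -
    have "(\<Sum>i=1..n. elog (nce_prob h g n m (\<theta>, \<nu>) (y i))) = (\<Sum>i=1..n. elog (r * saturate r (u (y i))))"
      using prob nonneg by (intro sum.cong) auto
    moreover have "(\<forall>i\<in>{1..n}. 0 < r * saturate r (u (y i))) \<longleftrightarrow> (\<forall>i\<in>{1..n}. 0 < u (y i))"
      using saturate_pos[OF uy] r by (simp add: zero_less_mult_iff)
    ultimately show ?thesis by (simp add: sum_elog)
  qed
  show ?thesis
    unfolding lik_NCE_def X Y u_def[symmetric] r_def[symmetric]
    using n by (simp add: diff_divide_distrib)
qed

section \<open>Ratios of unnormalised densities\<close>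

definition is_unnormalised_density :: "'x measure \<Rightarrow> ('x \<Rightarrow> real) \<Rightarrow> bool" where
  "is_unnormalised_density \<mu> f \<longleftrightarrow>
    integrable \<mu> f \<and> (\<forall>x\<in>space \<mu>. 0 \<le> f x) \<and> 0 < norm_const \<mu> f"

lemma unnormalised_densityD:
  assumes "is_unnormalised_density \<mu> f"
  shows "f \<in> borel_measurable \<mu>" "integrable \<mu> f" "x \<in> space \<mu> \<Longrightarrow> 0 \<le> f x" "0 < norm_const \<mu> f"
  using assms by (auto simp: is_unnormalised_density_def)

lemma measurable_norm_density:
  "is_unnormalised_density \<mu> f \<Longrightarrow> norm_density \<mu> f \<in> borel_measurable \<mu>"
  using unnormalised_densityD(1)[of \<mu> f] unfolding norm_density_def[abs_def] by measurable

lemma sets_model_prob [simp]: "sets (model_prob \<mu> f) = sets \<mu>"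
  and space_model_prob [simp]: "space (model_prob \<mu> f) = space \<mu>"
  by (simp_all add: model_prob_def)

lemma AE_model_prob:
  assumes f: "is_unnormalised_density \<mu> f"
  shows "(AE x in model_prob \<mu> f. R x) \<longleftrightarrow> (AE x in \<mu>. 0 < f x \<longrightarrow> R x)"
  unfolding model_prob_def using unnormalised_densityD(4)[OF f]
  by (subst AE_density[OF measurable_norm_density[OF f]])
    (simp add: norm_density_def zero_less_divide_iff)

text \<open>The zeros of \<open>g\<close> form a null set of the law of \<open>g\<close>, hence of the law of \<open>f\<close>.\<close>
lemma AE_dominated:
  assumes f: "is_unnormalised_density \<mu> f" and g: "is_unnormalised_density \<mu> g"
    and ac: "absolutely_continuous (model_prob \<mu> g) (model_prob \<mu> f)"
  shows "AE x in \<mu>. 0 < f x \<longrightarrow> 0 < g x"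
proof -
  note [measurable] = unnormalised_densityD(1)[OF g]
  have "AE x in model_prob \<mu> g. 0 < g x"
    unfolding AE_model_prob[OF g] by simp
  then have "{x \<in> space \<mu>. \<not> 0 < g x} \<in> null_sets (model_prob \<mu> g)"
    by (subst AE_iff_null_sets) auto
  then have "{x \<in> space \<mu>. \<not> 0 < g x} \<in> null_sets (model_prob \<mu> f)"
    using ac by (auto simp: absolutely_continuous_def)
  from AE_not_in[OF this] AE_space[of "model_prob \<mu> f"] have "AE x in model_prob \<mu> f. 0 < g x"
    by eventually_elim simp
  then show ?thesis unfolding AE_model_prob[OF f] .
qed

text \<open>The offset \<open>ln (norm_const \<mu> g / norm_const \<mu> f)\<close> is what turns the ratio of unnormalised densities into a
  density, which is why it is the limit of the estimated \<open>\<nu>\<close>. Domination is needed on the zeros of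
  \<open>g\<close>, where the real quotient is \<open>0\<close>.\<close>
lemma density_ratio:
  assumes f: "is_unnormalised_density \<mu> f" and g: "is_unnormalised_density \<mu> g"
    and dom: "AE x in \<mu>. 0 < f x \<longrightarrow> 0 < g x"
  shows "density (model_prob \<mu> g)
    (\<lambda>x. ennreal (exp (ln (norm_const \<mu> g / norm_const \<mu> f)) * (f x / g x))) = model_prob \<mu> f"
proof -
  note [measurable] = unnormalised_densityD(1)[OF f] unnormalised_densityD(1)[OF g]
  note Z = unnormalised_densityD(4)[OF f] unnormalised_densityD(4)[OF g]
  let ?w = "\<lambda>x. ennreal (exp (ln (norm_const \<mu> g / norm_const \<mu> f)) * (f x / g x))"
  have meas: "norm_density \<mu> g \<in> borel_measurable \<mu>" "norm_density \<mu> f \<in> borel_measurable \<mu>"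
    using f g by (auto intro: measurable_norm_density)
  have w: "?w \<in> borel_measurable \<mu>" by measurable
  have "AE x in \<mu>. norm_density \<mu> g x * ?w x = norm_density \<mu> f x"
    using dom AE_space
  proof eventually_elim
    case (elim x)
    have nonneg: "0 \<le> f x" "0 \<le> g x"
      using elim(2) unnormalised_densityD(3)[OF f] unnormalised_densityD(3)[OF g] by auto
    have "norm_density \<mu> g x * ?w x =
        ennreal (g x / norm_const \<mu> g * (norm_const \<mu> g / norm_const \<mu> f * (f x / g x)))"
      unfolding norm_density_def using Z nonneg by (subst ennreal_mult[symmetric]) auto
    also have "g x / norm_const \<mu> g * (norm_const \<mu> g / norm_const \<mu> f * (f x / g x))
        = f x / norm_const \<mu> f"
      using Z nonneg elim(1) by (cases "f x = 0") auto
    finally show ?case by (simp add: norm_density_def)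
  qed
  then show ?thesis
    unfolding model_prob_def using meas w
    by (subst density_density_eq) (auto intro!: density_cong)
qed

lemma integrable_ratio:
  assumes f: "is_unnormalised_density \<mu> f" and g: "is_unnormalised_density \<mu> g"
  shows "integrable (model_prob \<mu> g) (\<lambda>x. f x / g x)"
proof -
  note [measurable] = unnormalised_densityD(1)[OF f] unnormalised_densityD(1)[OF g]
  note Z = unnormalised_densityD(4)[OF f] unnormalised_densityD(4)[OF g]
  have nonneg: "AE x in \<mu>. 0 \<le> g x / norm_const \<mu> g"
    using AE_space by eventually_elim (use Z unnormalised_densityD(3)[OF g] in auto)
  have "integrable \<mu> (\<lambda>x. g x / norm_const \<mu> g * (f x / g x))"
  proof (rule Bochner_Integration.integrable_bound)
    show "integrable \<mu> (\<lambda>x. f x / norm_const \<mu> g)"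
      using unnormalised_densityD(2)[OF f] by simp
    show "AE x in \<mu>. norm (g x / norm_const \<mu> g * (f x / g x)) \<le> norm (f x / norm_const \<mu> g)"
      by (intro AE_I2) (simp add: divide_simps)
  qed measurable
  then show ?thesis
    unfolding model_prob_def norm_density_def[abs_def]
    by (subst integrable_density[OF _ _ nonneg]) auto
qed

text \<open>Proportional unnormalised densities give the same law, and integration recovers the constant. This is how
  identifiability of \<open>\<theta>\<close> yields identifiability of the pair \<open>(\<theta>, \<nu>)\<close>.\<close>
lemma model_prob_eqI:
  assumes f: "is_unnormalised_density \<mu> f" and f': "is_unnormalised_density \<mu> f'"
    and k: "0 < k" "0 < k'" and eq: "AE x in \<mu>. k * f x = k' * f' x"
  shows "model_prob \<mu> f = model_prob \<mu> f'" "k * norm_const \<mu> f = k' * norm_const \<mu> f'"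
proof -
  note [measurable] = unnormalised_densityD(1)[OF f] unnormalised_densityD(1)[OF f']
  note Z = unnormalised_densityD(4)[OF f] unnormalised_densityD(4)[OF f']
  have "(\<integral>x. k * f x \<partial>\<mu>) = (\<integral>x. k' * f' x \<partial>\<mu>)"
    by (rule integral_cong_AE[OF _ _ eq]) measurable
  then show Zeq: "k * norm_const \<mu> f = k' * norm_const \<mu> f'" by (simp add: norm_const_def)
  have "AE x in \<mu>. norm_density \<mu> f x = norm_density \<mu> f' x"
    using eq
  proof eventually_elim
    case (elim x)
    have "f x / norm_const \<mu> f = (k * f x) / (k * norm_const \<mu> f)" using k by simp
    also have "\<dots> = f' x / norm_const \<mu> f'" unfolding elim Zeq using k by simp
    finally show ?case by (simp add: norm_density_def)
  qed
  then show "model_prob \<mu> f = model_prob \<mu> f'"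
    unfolding model_prob_def
    by (intro density_cong measurable_norm_density f f')
qed

text \<open>The supremum over \<open>U\<close> need not be measurable, so the integrable bound is the supremum over a countable
  dense subset, which continuity extends to all of \<open>U\<close>.\<close>
lemma trunc_ln_ratio_dominated:
  fixes h :: "'p::{metric_space, second_countable_topology} \<Rightarrow> 'x \<Rightarrow> real"
  assumes U: "open U"
    and h: "\<And>q. q \<in> U \<Longrightarrow> is_unnormalised_density \<mu> (h q)"
    and h0: "is_unnormalised_density \<mu> h0"
    and cont: "AE x in model_prob \<mu> h0. continuous_on U (\<lambda>q. h q x)"
    and fin: "(\<integral>\<^sup>+ x. (SUP q\<in>U. e2ennreal (max (elog (h q x / h0 x)) 0)) * ennreal (h0 x) \<partial>\<mu>) < \<infinity>"
  shows "\<exists>S. integrable (model_prob \<mu> h0) S \<and>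
    (AE x in model_prob \<mu> h0. 0 < h0 x \<and> (\<forall>q\<in>U. max 0 (trunc_ln (h q x / h0 x)) \<le> S x))"
proof -
  note [measurable] = unnormalised_densityD(1)[OF h0]
  note Z = unnormalised_densityD(4)[OF h0]
  obtain D :: "'p set" where D: "countable D" "\<And>W. open W \<Longrightarrow> W \<noteq> {} \<Longrightarrow> \<exists>d\<in>D. d \<in> W"
    by (rule countable_dense_setE) blast
  define S where "S x = (SUP q\<in>D \<inter> U. ennreal (max 0 (trunc_ln (h q x / h0 x))))" for x
  have h_meas [measurable]: "h q \<in> borel_measurable \<mu>" if "q \<in> D \<inter> U" for q
    using unnormalised_densityD(1)[OF h] that by auto
  have S_meas [measurable]: "S \<in> borel_measurable \<mu>"
    unfolding S_def
  proof (rule borel_measurable_SUP)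
    show "countable (D \<inter> U)" using D(1) by simp
    fix q assume "q \<in> D \<inter> U"
    note [measurable] = h_meas[OF this]
    show "(\<lambda>x. ennreal (max 0 (trunc_ln (h q x / h0 x)))) \<in> borel_measurable \<mu>" by measurable
  qed
  have "(\<integral>\<^sup>+ x. S x * ennreal (h0 x) \<partial>\<mu>)
      \<le> (\<integral>\<^sup>+ x. (SUP q\<in>U. e2ennreal (max (elog (h q x / h0 x)) 0)) * ennreal (h0 x) \<partial>\<mu>)"
    unfolding S_def trunc_ln_pos_part by (intro nn_integral_mono mult_right_mono SUP_subset_mono) auto
  then have S_fin: "(\<integral>\<^sup>+ x. S x * ennreal (h0 x) \<partial>\<mu>) < \<infinity>" using fin by (rule le_less_trans)
  have "(\<integral>\<^sup>+ x. S x \<partial>model_prob \<mu> h0) = (\<integral>\<^sup>+ x. norm_density \<mu> h0 x * S x \<partial>\<mu>)"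
    unfolding model_prob_def
    by (rule nn_integral_density[OF measurable_norm_density[OF h0] S_meas])
  also have "\<dots> = (\<integral>\<^sup>+ x. ennreal (1 / norm_const \<mu> h0) * (S x * ennreal (h0 x)) \<partial>\<mu>)"
  proof (rule nn_integral_cong)
    fix x assume "x \<in> space \<mu>"
    then have "0 \<le> h0 x" by (rule unnormalised_densityD(3)[OF h0])
    then have "norm_density \<mu> h0 x = ennreal (1 / norm_const \<mu> h0) * ennreal (h0 x)"
      unfolding norm_density_def using Z by (subst ennreal_mult[symmetric]) auto
    then show "norm_density \<mu> h0 x * S x = ennreal (1 / norm_const \<mu> h0) * (S x * ennreal (h0 x))"
      by (simp add: mult_ac)
  qed
  also have "\<dots> = ennreal (1 / norm_const \<mu> h0) * (\<integral>\<^sup>+ x. S x * ennreal (h0 x) \<partial>\<mu>)"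
    by (rule nn_integral_cmult) measurable
  also have "\<dots> < \<infinity>" using S_fin by (simp add: ennreal_mult_less_top)
  finally have S_fin': "(\<integral>\<^sup>+ x. S x \<partial>model_prob \<mu> h0) < \<infinity>" .
  have S_meas': "S \<in> borel_measurable (model_prob \<mu> h0)"
    using S_meas by (simp add: model_prob_def)
  have S_less: "AE x in model_prob \<mu> h0. S x \<noteq> \<infinity>"
    using S_fin' by (intro nn_integral_PInf_AE[OF S_meas']) auto
  have "integrable (model_prob \<mu> h0) (\<lambda>x. enn2real (S x))"
  proof (rule integrableI_nonneg)
    show "(\<lambda>x. enn2real (S x)) \<in> borel_measurable (model_prob \<mu> h0)"
      using S_meas' by measurable
    have "(\<integral>\<^sup>+ x. ennreal (enn2real (S x)) \<partial>model_prob \<mu> h0) \<le> (\<integral>\<^sup>+ x. S x \<partial>model_prob \<mu> h0)"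
      by (intro nn_integral_mono) (metis enn2real_nonneg ennreal_enn2real_if top_greatest order_refl zero_le)
    then show "(\<integral>\<^sup>+ x. ennreal (enn2real (S x)) \<partial>model_prob \<mu> h0) < \<infinity>"
      using S_fin' by (rule le_less_trans)
  qed simp
  moreover have pos: "AE x in model_prob \<mu> h0. 0 < h0 x"
    unfolding AE_model_prob[OF h0] by simp
  have "AE x in model_prob \<mu> h0. 0 < h0 x \<and> (\<forall>q\<in>U. max 0 (trunc_ln (h q x / h0 x)) \<le> enn2real (S x))"
    using cont S_less pos
  proof eventually_elim
    case (elim x)
    have "max 0 (trunc_ln (h q x / h0 x)) \<le> enn2real (S x)" if q: "q \<in> U" for q
    proof (rule continuous_le_from_dense[OF U _ D(2) _ q])
      show "continuous_on U (\<lambda>q. max 0 (trunc_ln (h q x / h0 x)))"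
        using elim by (intro continuous_intros) auto
      fix d assume "d \<in> D \<inter> U"
      then have "ennreal (max 0 (trunc_ln (h d x / h0 x))) \<le> S x"
        unfolding S_def by (rule SUP_upper)
      also have "S x = ennreal (enn2real (S x))"
        using elim(2) by (simp add: less_top)
      finally show "max 0 (trunc_ln (h d x / h0 x)) \<le> enn2real (S x)"
        by (subst (asm) ennreal_le_iff) auto
    qed
    with elim(3) show ?case by blast
  qed
  ultimately show ?thesis by blast
qed

section \<open>Strong consistency of both estimators\<close>

theorem theorem3:
  fixes \<Theta> :: "(real ^ 'd) set"
    and \<X> :: "(real ^ 'k) set"
    and \<mu> :: "(real ^ 'k) measure"
    and h :: "real ^ 'd \<Rightarrow> real ^ 'k \<Rightarrow> real"
    and h\<psi> :: "real ^ 'k \<Rightarrow> real"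
    and \<theta>s :: "real ^ 'd"
    and M :: "'w measure"
    and X Y :: "nat \<Rightarrow> 'w \<Rightarrow> real ^ 'k"
    and m :: "nat \<Rightarrow> nat"
    and \<tau> :: real
    and \<xi>IS \<xi>NCE :: "nat \<Rightarrow> 'w \<Rightarrow> (real ^ 'd) \<times> real"
  defines "P \<equiv> \<lambda>\<theta>. model_prob \<mu> (h \<theta>)"
    and "P\<psi> \<equiv> model_prob \<mu> h\<psi>"
    and "\<Xi> \<equiv> \<Theta> \<times> (UNIV :: real set)"
    and "\<xi>s \<equiv> (\<theta>s, ln (norm_const \<mu> h\<psi> / norm_const \<mu> (h \<theta>s)))"
  assumes Theta: "open \<Theta>"
    and mu: "sets \<mu> = sets (restrict_space borel \<X>)"
    and h_nonneg: "\<forall>\<theta>\<in>\<Theta>. \<forall>x\<in>\<X>. 0 \<le> h \<theta> x"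
    and h_int: "\<forall>\<theta>\<in>\<Theta>. integrable \<mu> (h \<theta>) \<and> 0 < norm_const \<mu> (h \<theta>)"
    and psi_nonneg: "\<forall>x\<in>\<X>. 0 \<le> h\<psi> x"
    and psi_int: "integrable \<mu> h\<psi>" "0 < norm_const \<mu> h\<psi>"
    and identifiable: "inj_on P \<Theta>"
    and dominated: "\<forall>\<theta>\<in>\<Theta>. absolutely_continuous P\<psi> (P \<theta>)"
    and M: "prob_space M"
    and theta_star: "\<theta>s \<in> \<Theta>"
    and Y_indep: "prob_space.indep_vars M (\<lambda>_. \<mu>) Y {1..}"
    and Y_distr: "\<forall>i\<ge>1. distributed M \<mu> (Y i) (norm_density \<mu> (h \<theta>s))"
    and YX_indep: "prob_space.indep_var M
          (Pi\<^sub>M {1..} (\<lambda>_. \<mu>)) (\<lambda>\<omega>. \<lambda>i\<in>{1..}. Y i \<omega>)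
          (Pi\<^sub>M {1..} (\<lambda>_. \<mu>)) (\<lambda>\<omega>. \<lambda>j\<in>{1..}. X j \<omega>)"
    and m: "mono_on {1..} m" "\<forall>n\<ge>1. 0 < m n" "filterlim m at_top sequentially"
    and tau: "0 < \<tau>" "(\<lambda>n. real (m n) / real n) \<longlonglongrightarrow> \<tau>"
    and X1: "ergodic_process M \<mu> P\<psi> X"
    and C2_rv: "\<forall>n\<ge>1. \<xi>IS n \<in> borel_measurable M" "\<forall>n\<ge>1. \<xi>NCE n \<in> borel_measurable M"
    and C2_IS: "approx_maximiser M \<Xi>
          (\<lambda>n \<omega>. lik_IS h h\<psi> (\<lambda>i. Y i \<omega>) (\<lambda>j. X j \<omega>) n (m n)) \<xi>IS"
    and C2_NCE: "approx_maximiser M \<Xi>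
          (\<lambda>n \<omega>. lik_NCE h h\<psi> (\<lambda>i. Y i \<omega>) (\<lambda>j. X j \<omega>) n (m n)) \<xi>NCE"
    and C2_compact: "\<exists>K. compact K \<and> K \<subseteq> \<Xi> \<and> (AE \<omega> in M. \<forall>n\<ge>1. \<xi>IS n \<omega> \<in> K \<and> \<xi>NCE n \<omega> \<in> K)"
    and H3_cont: "AE x in P\<psi>. continuous_on \<Theta> (\<lambda>\<theta>. h \<theta> x)"
    and H3_int: "\<forall>\<theta>\<in>\<Theta>. \<exists>\<epsilon>>0.
          (\<integral>\<^sup>+ x. (SUP \<phi>\<in>ball \<theta> \<epsilon> \<inter> \<Theta>. e2ennreal (max (elog (h \<phi> x / h \<theta>s x)) 0))
                  * ennreal (h \<theta>s x) \<partial>\<mu>) < \<infinity>"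
  shows "(AE \<omega> in M. (\<lambda>n. \<xi>IS n \<omega>) \<longlonglongrightarrow> \<xi>s) \<and> (AE \<omega> in M. (\<lambda>n. \<xi>NCE n \<omega>) \<longlonglongrightarrow> \<xi>s)"
proof -
  note nonneg = h_nonneg psi_nonneg
  have space_mu: "space \<mu> = \<X>"
    using sets_eq_imp_space_eq[OF mu] by (simp add: space_restrict_space)
  have dens: "is_unnormalised_density \<mu> (h \<theta>)" if "\<theta> \<in> \<Theta>" for \<theta>
    using that h_nonneg h_int by (simp add: is_unnormalised_density_def space_mu)
  have dens_psi: "is_unnormalised_density \<mu> h\<psi>"
    using psi_nonneg psi_int by (simp add: is_unnormalised_density_def space_mu)
  note dens_s = dens[OF theta_star]
  define a where "a q x = exp (snd q) * (h (fst q) x / h\<psi> x)" for q x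
  have fst_\<Xi>: "fst q \<in> \<Theta>" if "q \<in> \<Xi>" for q using that by (auto simp: \<Xi>_def)
  have dom: "AE x in \<mu>. 0 < h \<theta> x \<longrightarrow> 0 < h\<psi> x" if "\<theta> \<in> \<Theta>" for \<theta>
    using dominated that unfolding P_def P\<psi>_def
    by (intro AE_dominated[OF dens dens_psi]) auto
  have Q: "density P\<psi> (\<lambda>x. ennreal (a \<xi>s x)) = P \<theta>s"
    unfolding a_def \<xi>s_def P\<psi>_def P_def fst_conv snd_conv
    by (rule density_ratio[OF dens_s dens_psi dom[OF theta_star]])
  interpret M: prob_space M by (rule M)
  have sets_P\<psi>: "sets P\<psi> = sets \<mu>" and space_P\<psi>: "space P\<psi> = \<X>"
    by (simp_all add: P\<psi>_def space_mu)
  have Y_meas: "Y i \<in> measurable M \<mu>" if "1 \<le> i" for i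
    using Y_distr that by (auto simp: distributed_def)
  have Y_law: "distr M \<mu> (Y i) = P \<theta>s" if "1 \<le> i" for i
    using Y_distr that by (auto simp: distributed_def P_def model_prob_def)
  have prob_P\<theta>s: "prob_space (P \<theta>s)"
    using M.prob_space_distr[OF Y_meas[of 1]] Y_law[of 1] by simp
  interpret two_samples P\<psi> a \<Xi> \<xi>s M X Y
  proof (intro two_samples.intro tilted_family.intro two_samples_axioms.intro)
    show "prob_space M" by (rule M)
    show "open \<Xi>" unfolding \<Xi>_def using Theta by (intro open_Times) auto
    show "\<xi>s \<in> \<Xi>" using theta_star by (simp add: \<Xi>_def \<xi>s_def)
    show "0 \<le> a q x" if "q \<in> \<Xi>" "x \<in> space P\<psi>" for q x
      using that nonneg fst_\<Xi> by (auto simp: a_def space_P\<psi>)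
    show "integrable P\<psi> (a q)" if "q \<in> \<Xi>" for q
      using integrable_ratio[OF dens[OF fst_\<Xi>[OF that]] dens_psi]
      unfolding a_def[abs_def] P\<psi>_def by (rule integrable_mult_right)
    show "AE x in P\<psi>. continuous_on \<Xi> (\<lambda>q. a q x)"
      using H3_cont
    proof eventually_elim
      case (elim x)
      have "continuous_on \<Xi> (\<lambda>q. h (fst q) x)"
        by (rule continuous_on_compose2[OF elim]) (auto intro: continuous_intros fst_\<Xi>)
      then show "continuous_on \<Xi> (\<lambda>q. a q x)"
        unfolding a_def divide_inverse by (intro continuous_intros)
    qed
    show "q = \<xi>s" if q: "q \<in> \<Xi>" and eq: "AE x in P\<psi>. a q x = a \<xi>s x" for q
    proof -
      note dens_q = dens[OF fst_\<Xi>[OF q]]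
      have "AE x in \<mu>. 0 < h\<psi> x \<longrightarrow> a q x = a \<xi>s x"
        using eq unfolding P\<psi>_def AE_model_prob[OF dens_psi] .
      then have eq': "AE x in \<mu>. exp (snd q) * h (fst q) x = exp (snd \<xi>s) * h \<theta>s x"
        using dom[OF fst_\<Xi>[OF q]] dom[OF theta_star] AE_space
      proof eventually_elim
        case (elim x)
        have "0 \<le> h (fst q) x" "0 \<le> h \<theta>s x"
          using elim(4) unnormalised_densityD(3)[OF dens_q] unnormalised_densityD(3)[OF dens_s] by auto
        with elim show ?case
          by (cases "0 < h\<psi> x") (auto simp: a_def \<xi>s_def order.order_iff_strict)
      qed
      have "P (fst q) = P \<theta>s"
        unfolding P_def by (rule model_prob_eqI(1)[OF dens_q dens_s _ _ eq']) auto
      then have \<theta>: "fst q = \<theta>s"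
        using identifiable fst_\<Xi>[OF q] theta_star by (auto dest: inj_onD)
      moreover have "exp (snd q) * norm_const \<mu> (h (fst q)) = exp (snd \<xi>s) * norm_const \<mu> (h \<theta>s)"
        by (rule model_prob_eqI(2)[OF dens_q dens_s _ _ eq']) auto
      ultimately have "snd q = snd \<xi>s"
        using unnormalised_densityD(4)[OF dens_s] by simp
      with \<theta> show ?thesis by (simp add: prod_eq_iff \<xi>s_def)
    qed
    show "\<exists>V S. open V \<and> q \<in> V \<and> integrable (density P\<psi> (a \<xi>s)) S \<and>
      (AE x in density P\<psi> (a \<xi>s). \<forall>q'\<in>V \<inter> \<Xi>. trunc_ln (a q' x / a \<xi>s x) \<le> S x)"
      if q: "q \<in> \<Xi>" for q
    proof -
      obtain \<epsilon> where \<epsilon>: "0 < \<epsilon>" and fin: "(\<integral>\<^sup>+ x. (SUP \<phi>\<in>ball (fst q) \<epsilon> \<inter> \<Theta>.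
          e2ennreal (max (elog (h \<phi> x / h \<theta>s x)) 0)) * ennreal (h \<theta>s x) \<partial>\<mu>) < \<infinity>"
        using H3_int fst_\<Xi>[OF q] by blast
      let ?B = "ball (fst q) \<epsilon> \<inter> \<Theta>"
      have AE_trans: "AE x in P \<theta>s. R x" if "AE x in P\<psi>. R x" for R
      proof (rule absolutely_continuous_AE[OF _ _ that])
        show "sets (P \<theta>s) = sets P\<psi>" by (simp add: P_def P\<psi>_def)
        show "absolutely_continuous P\<psi> (P \<theta>s)" using dominated theta_star by blast
      qed
      have cont: "AE x in model_prob \<mu> (h \<theta>s). continuous_on ?B (\<lambda>\<theta>. h \<theta> x)"
        using AE_trans[OF H3_cont] unfolding P_def
        by eventually_elim (rule continuous_on_subset, auto)
      have "open ?B" using Theta by auto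
      from trunc_ln_ratio_dominated[OF this dens dens_s cont fin]
      obtain S where S: "integrable (P \<theta>s) S"
        and S_ge: "AE x in P \<theta>s. 0 < h \<theta>s x \<and> (\<forall>\<phi>\<in>?B. max 0 (trunc_ln (h \<phi> x / h \<theta>s x)) \<le> S x)"
        unfolding P_def by auto
      define V where "V = ball (fst q) \<epsilon> \<times> ball (snd q) 1"
      \<comment> \<open>A change of \<open>\<nu>\<close> shifts the log-ratio by a constant, which is bounded on a unit ball.\<close>
      define C where "C = \<bar>snd q - snd \<xi>s\<bar> + 1"
      have "open V" "q \<in> V" using \<epsilon> by (auto simp: V_def open_Times mem_Times_iff)
      moreover have "integrable (P \<theta>s) (\<lambda>x. S x + C)"
      proof -
        interpret P\<theta>s: prob_space "P \<theta>s" by (rule prob_P\<theta>s)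
        show ?thesis using S by simp
      qed
      moreover have "AE x in P \<theta>s. 0 < h\<psi> x"
        using dom[OF theta_star] unfolding P_def AE_model_prob[OF dens_s] .
      then have "AE x in P \<theta>s. \<forall>q'\<in>V \<inter> \<Xi>. trunc_ln (a q' x / a \<xi>s x) \<le> S x + C"
        using S_ge AE_space
      proof eventually_elim
        case (elim x)
        show ?case
        proof
          fix q' assume q': "q' \<in> V \<inter> \<Xi>"
          then have B: "fst q' \<in> ?B" and \<nu>: "\<bar>snd q' - snd \<xi>s\<bar> \<le> C"
            using fst_\<Xi> by (auto simp: V_def C_def dist_real_def)
          have "x \<in> \<X>" using elim(3) by (simp add: P_def space_mu)
          then have "0 \<le> h (fst q') x / h \<theta>s x" using h_nonneg B theta_star by simp
          moreover have "a q' x / a \<xi>s x = exp (snd q' - snd \<xi>s) * (h (fst q') x / h \<theta>s x)"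
            using elim(1) by (simp add: a_def \<xi>s_def exp_diff)
          ultimately have "trunc_ln (a q' x / a \<xi>s x)
              \<le> max 0 (trunc_ln (h (fst q') x / h \<theta>s x)) + \<bar>snd q' - snd \<xi>s\<bar>"
            by (simp only: trunc_ln_exp_mult_le)
          moreover have "max 0 (trunc_ln (h (fst q') x / h \<theta>s x)) \<le> S x"
            using elim(2) B by blast
          ultimately show "trunc_ln (a q' x / a \<xi>s x) \<le> S x + C"
            using \<nu> by linarith
        qed
      qed
      ultimately show ?thesis unfolding Q by blast
    qed
    show "prob_space (density P\<psi> (a \<xi>s))" unfolding Q by (rule prob_P\<theta>s)
    show "X j \<omega> \<in> space P\<psi>" if "1 \<le> j" "\<omega> \<in> space M" for j \<omega>
      using X1 that measurable_space[of "X j" M \<mu> \<omega>]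
      by (auto simp: ergodic_process_def space_P\<psi> space_mu)
    show "AE \<omega> in M. (\<lambda>m. (\<Sum>j=1..m. \<phi> (X j \<omega>)) / real m) \<longlonglongrightarrow> (\<integral>x. \<phi> x \<partial>P\<psi>)"
      if "integrable P\<psi> \<phi>" for \<phi>
      using X1 that by (auto simp: ergodic_process_def)
    show "M.indep_vars (\<lambda>_. P\<psi>) Y {1..}"
      using Y_indep sets_P\<psi> unfolding M.indep_vars_def2
      by (simp add: measurable_cong_sets[OF refl sets_P\<psi>])
    show "distr M P\<psi> (Y i) = density P\<psi> (a \<xi>s)" if "1 \<le> i" for i
      unfolding Q Y_law[OF that, symmetric] by (rule distr_cong) (auto simp: sets_P\<psi>)
  qed
  obtain K where K: "compact K" "K \<subseteq> \<Xi>" and in_K: "AE \<omega> in M. \<forall>n\<ge>1. \<xi>IS n \<omega> \<in> K \<and> \<xi>NCE n \<omega> \<in> K"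
    using C2_compact by blast
  have IS_K: "AE \<omega> in M. \<forall>n\<ge>1. \<xi>IS n \<omega> \<in> K" and NCE_K: "AE \<omega> in M. \<forall>n\<ge>1. \<xi>NCE n \<omega> \<in> K"
    using in_K by (eventually_elim, blast)+
  have IS_\<Xi>: "AE \<omega> in M. \<forall>n\<ge>1. \<xi>IS n \<omega> \<in> \<Xi>" and NCE_\<Xi>: "AE \<omega> in M. \<forall>n\<ge>1. \<xi>NCE n \<omega> \<in> \<Xi>"
    using IS_K NCE_K by (eventually_elim, use K(2) in blast)+
  have "AE \<omega> in M. (\<lambda>n. \<xi>IS n \<omega>) \<longlonglongrightarrow> \<xi>s"
  proof (rule IS_consistency[OF K IS_K m(3) near_maximiser_real[OF C2_IS _ IS_\<Xi>]])
    fix n :: nat and \<omega> and q :: "(real ^ 'd) \<times> real"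
    assume "1 \<le> n"
    then show "lik_IS h h\<psi> (\<lambda>i. Y i \<omega>) (\<lambda>j. X j \<omega>) n (m n) q =
        (if \<forall>i\<in>{1..n}. 0 < a q (Y i \<omega>) then ereal (IS_obj n (m n) q \<omega>) else - \<infinity>)"
      unfolding IS_obj_def a_def by (cases q) (simp only: fst_conv snd_conv, rule lik_IS_eq, simp)
  qed
  moreover have "AE \<omega> in M. (\<lambda>n. \<xi>NCE n \<omega>) \<longlonglongrightarrow> \<xi>s"
  proof (rule NCE_consistency[OF K NCE_K m(3,2) tau near_maximiser_real[OF C2_NCE _ NCE_\<Xi>]])
    fix n :: nat and \<omega> and q :: "(real ^ 'd) \<times> real"
    assume n: "1 \<le> n" and \<omega>: "\<omega> \<in> space M" and q: "q \<in> \<Xi>"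
    obtain \<theta> \<nu> where q_eq: "q = (\<theta>, \<nu>)" by (cases q)
    have \<theta>: "\<theta> \<in> \<Theta>" using fst_\<Xi>[OF q] by (simp add: q_eq)
    have Y\<X>: "Y i \<omega> \<in> \<X>" if "i \<in> {1..n}" for i
      using measurable_space[OF Y_meas \<omega>] that by (simp add: space_mu)
    have X\<X>: "X j \<omega> \<in> \<X>" if "j \<in> {1..m n}" for j
      using X_space[OF _ \<omega>] that by (simp add: space_P\<psi>)
    show "lik_NCE h h\<psi> (\<lambda>i. Y i \<omega>) (\<lambda>j. X j \<omega>) n (m n) q =
        (if \<forall>i\<in>{1..n}. 0 < a q (Y i \<omega>) then ereal (NCE_obj n (m n) q \<omega>) else - \<infinity>)"
      unfolding NCE_obj_def a_def q_eq fst_conv snd_conv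
      by (rule lik_NCE_eq) (use n m(2) nonneg \<theta> Y\<X> X\<X> in auto)
  qed
  ultimately show ?thesis ..
qed

end
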